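(* Consider the weighted stochastic block model SBM$(p,q,\alpha_n)$ on $n$ nodes with $d$-uniform hyperedges and $k$ groups in the binary-valued edge case (all $W_e\in\{0,1\}$). There is no estimator which (i) solves detection when $\binom{n}{d}\alpha_n=o(n)$; (ii) is weakly consistent when $\binom{n}{d}\alpha_n=O(n)$; (iii) is strongly consistent when $\binom{n}{d}\alpha_n=o(n\log n)$.
   Context: Model. The integers $d\ge 2$ (edge size) and $k\ge 2$ (number of groups) and the real constants $p>q\ge 0$ are fixed; $n\to\infty$. Nodes are $[n]$ and $\mathcal{E}=\binom{[n]}{d}$ is the set of all $d$-subsets of $[n]$. A hidden partition is a map $\Psi:[n]\to[k]$ whose group sizes are all linear in $n$ (the ratio of largest to smallest group size is bounded by a fixed constant $C>1$). An edge $e$ is homogeneous if $\Psi$ is constant on $e$, heterogeneous otherwise. In the binary-valued edge case the weights $W_e$, $e\in\mathcal{E}$, are independent with $W_e\sim\mathrm{Bern}(p\alpha_n)$ for homogeneous $e$ and $W_e\sim\mathrm{Bern}(q\alpha_n)$ for heterogeneous $e$. An estimator $\Phi$ is a (possibly randomized) function of $\{W_e\}_{e\in\mathcal{E}}$, not of $\Psi$, with values in the maps $[n]\to[k]$. A recovery guarantee for an estimator is required to hold for every sequence (in $n$) of admissible hidden partitions $\Psi$. With $\mathrm{err}(\Phi)=\frac1n\min_{\Pi}|\{i:\Psi(i)\ne\Pi(\Phi(i))\}|$ (minimum over permutations $\Pi$ of $[k]$), $\Phi$ is strongly consistent if $\lim_{n\to\infty}\Pr(\mathrm{err}(\Phi)=0)=1$,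 and weakly consistent if $\mathrm{err}(\Phi)\to0$ in probability. $\Phi$ solves detection if its output is more consistent with the hidden partition than a random guess: there is a constant $\varepsilon>0$ such that with probability $1-o(1)$ there exist $i,j,\ell\in[k]$ such that $S=\Phi^{-1}(\ell)$ satisfies $\frac{|\Psi^{-1}(i)\cap S|}{|\Psi^{-1}(i)|}-\frac{|\Psi^{-1}(j)\cap S|}{|\Psi^{-1}(j)|}\ge\varepsilon$. *)

theory Defs
  imports "HOL-Probability.Probability" "HOL-Library.Landau_Symbols" "HOL-Library.Ramsey"
begin

definition labelings :: "nat \<Rightarrow> nat \<Rightarrow> (nat \<Rightarrow> nat) set" where
  "labelings n k = {1..n} \<rightarrow>\<^sub>E {1..k}"

definition group_of :: "nat \<Rightarrow> (nat \<Rightarrow> nat) \<Rightarrow> nat \<Rightarrow> nat set" where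
  "group_of n \<Psi> i = {v \<in> {1..n}. \<Psi> v = i}"

text \<open>The ratio of largest to smallest group size is at most \<open>C\<close>, written without division.
  For \<open>n \<ge> 1\<close> this forces every group to be nonempty, and hence all group sizes to be linear
  in \<open>n\<close>.\<close>

definition admissible :: "real \<Rightarrow> nat \<Rightarrow> nat \<Rightarrow> (nat \<Rightarrow> nat) \<Rightarrow> bool" where
  "admissible C k n \<Psi> \<longleftrightarrow> \<Psi> \<in> labelings n k \<and>
     (\<forall>i\<in>{1..k}. \<forall>j\<in>{1..k}.
        real (card (group_of n \<Psi> i)) \<le> C * real (card (group_of n \<Psi> j)))"

text \<open>For small \<open>n\<close> (for instance \<open>1 \<le> n < k\<close>) there is no admissible partition, so admissibility
  can only be asked for all large \<open>n\<close>; asking it for all \<open>n\<close> would leave no sequence at all.\<close>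

definition admissible_seq :: "real \<Rightarrow> nat \<Rightarrow> (nat \<Rightarrow> nat \<Rightarrow> nat) \<Rightarrow> bool" where
  "admissible_seq C k \<Psi> \<longleftrightarrow> (\<forall>\<^sub>F n in sequentially. admissible C k n (\<Psi> n))"

text \<open>The law of the edge weights on the \<open>d\<close>-subsets of \<open>{1..n}\<close>; \<open>a\<close> is the value of the scaling
  sequence at \<open>n\<close>. The weights 1 and 0 are \<open>True\<close> and \<open>False\<close>. The function is \<open>False\<close> on sets that
  are not edges and so carries no information there.\<close>

definition sbm_pmf ::
  "nat \<Rightarrow> real \<Rightarrow> real \<Rightarrow> real \<Rightarrow> nat \<Rightarrow> (nat \<Rightarrow> nat) \<Rightarrow> (nat set \<Rightarrow> bool) pmf" where
  "sbm_pmf d p q a n \<Psi> =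
     Pi_pmf (nsets {1..n} d) False
       (\<lambda>e. if \<Psi> constant_on e then bernoulli_pmf (p * a) else bernoulli_pmf (q * a))"

text \<open>A randomized estimator is a sequence, indexed by \<open>n\<close>, of kernels from weights to labelings:
  given the weights, its output is drawn independently of everything else. As there are only
  finitely many weights and labelings for each \<open>n\<close>, no measurability condition is involved.\<close>

type_synonym estimator = "nat \<Rightarrow> (nat set \<Rightarrow> bool) \<Rightarrow> (nat \<Rightarrow> nat) pmf"

definition is_estimator :: "nat \<Rightarrow> estimator \<Rightarrow> bool" where
  "is_estimator k \<Phi> \<longleftrightarrow> (\<forall>n w. set_pmf (\<Phi> n w) \<subseteq> labelings n k)"

definition output_pmf ::
  "nat \<Rightarrow> real \<Rightarrow> real \<Rightarrow> (nat \<Rightarrow> real) \<Rightarrow> (nat \<Rightarrow> nat \<Rightarrow> nat) \<Rightarrow> estimator \<Rightarrow> nat \<Rightarrow> (nat \<Rightarrow> nat) pmf" where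
  "output_pmf d p q \<alpha> \<Psi> \<Phi> n = bind_pmf (sbm_pmf d p q (\<alpha> n) n (\<Psi> n)) (\<Phi> n)"

definition err :: "nat \<Rightarrow> nat \<Rightarrow> (nat \<Rightarrow> nat) \<Rightarrow> (nat \<Rightarrow> nat) \<Rightarrow> real" where
  "err k n \<Psi> \<phi> =
     1 / real n * real (MIN \<pi>\<in>{\<pi>. \<pi> permutes {1..k}}. card {i \<in> {1..n}. \<Psi> i \<noteq> \<pi> (\<phi> i)})"

definition strongly_consistent ::
  "nat \<Rightarrow> nat \<Rightarrow> real \<Rightarrow> real \<Rightarrow> real \<Rightarrow> (nat \<Rightarrow> real) \<Rightarrow> estimator \<Rightarrow> bool" where
  "strongly_consistent d k C p q \<alpha> \<Phi> \<longleftrightarrow>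
     (\<forall>\<Psi>. admissible_seq C k \<Psi> \<longrightarrow>
        (\<lambda>n. measure_pmf.prob (output_pmf d p q \<alpha> \<Psi> \<Phi> n) {\<phi>. err k n (\<Psi> n) \<phi> = 0})
          \<longlonglongrightarrow> 1)"

definition weakly_consistent ::
  "nat \<Rightarrow> nat \<Rightarrow> real \<Rightarrow> real \<Rightarrow> real \<Rightarrow> (nat \<Rightarrow> real) \<Rightarrow> estimator \<Rightarrow> bool" where
  "weakly_consistent d k C p q \<alpha> \<Phi> \<longleftrightarrow>
     (\<forall>\<Psi>. admissible_seq C k \<Psi> \<longrightarrow>
        (\<forall>\<epsilon>>0. (\<lambda>n. measure_pmf.prob (output_pmf d p q \<alpha> \<Psi> \<Phi> n) {\<phi>. err k n (\<Psi> n) \<phi> > \<epsilon>})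
          \<longlonglongrightarrow> 0))"

definition detects :: "nat \<Rightarrow> nat \<Rightarrow> real \<Rightarrow> (nat \<Rightarrow> nat) \<Rightarrow> (nat \<Rightarrow> nat) \<Rightarrow> bool" where
  "detects k n \<epsilon> \<Psi> \<phi> \<longleftrightarrow>
     (\<exists>i\<in>{1..k}. \<exists>j\<in>{1..k}. \<exists>l\<in>{1..k}.
        let S = group_of n \<phi> l in
          real (card (group_of n \<Psi> i \<inter> S)) / real (card (group_of n \<Psi> i))
        - real (card (group_of n \<Psi> j \<inter> S)) / real (card (group_of n \<Psi> j)) \<ge> \<epsilon>)"

text \<open>The constant \<open>\<epsilon>\<close> may depend on the sequence of hidden partitions. This is the weaker of the two
  possible requirements, so that ruling it out also rules out a uniform \<open>\<epsilon>\<close>.\<close>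

definition solves_detection ::
  "nat \<Rightarrow> nat \<Rightarrow> real \<Rightarrow> real \<Rightarrow> real \<Rightarrow> (nat \<Rightarrow> real) \<Rightarrow> estimator \<Rightarrow> bool" where
  "solves_detection d k C p q \<alpha> \<Phi> \<longleftrightarrow>
     (\<forall>\<Psi>. admissible_seq C k \<Psi> \<longrightarrow>
        (\<exists>\<epsilon>>0. (\<lambda>n. measure_pmf.prob (output_pmf d p q \<alpha> \<Psi> \<Phi> n) {\<phi>. detects k n \<epsilon> (\<Psi> n) \<phi>})
          \<longlonglongrightarrow> 1))"

end

theory Submission
  imports Defs "HOL-Real_Asymp.Real_Asymp"
begin

text \<open>
  In all three regimes the obstruction is symmetry. Call a set of nodes isolated if no edge of weight 1
  meets it. Rearranging the hidden labels within an isolated set amounts to permuting its nodes, and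
  such a permutation leaves the weights as they are. So the weights have exactly the same likelihood
  before and after the rearrangement (\<open>pmf_sbm_isolated_swap\<close>): they carry no information on how the
  labels are arranged there.

  To exploit this, the nodes are cut into blocks of \<open>k\<close> consecutive nodes. Each block carries every
  label once, and the labels of each of the first \<open>m\<close> blocks are shifted cyclically by an independent
  uniform amount. Group sizes then differ by at most one, so all these partitions are eventually
  admissible for every \<open>C > 1\<close>. Conditionally on the weights, the shift of an isolated block is still
  uniform, hence an estimator can only guess it; \<open>averaging\<close> turns this into a bound on averages over
  the shifts. A bound on the average yields a bad partition for each \<open>n\<close>, and
  \<open>choose_admissible_seq\<close> collects these into one bad sequence.

  It remains to see how many blocks are isolated. A block meets at most
  \<open>k * ((n - 1) choose (d - 1))\<close> edges, so for large \<open>n\<close> it is isolated with probability at least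
  \<open>exp (- 2 * p * k * deg n)\<close>, where \<open>deg n\<close> is \<open>d / n\<close> times the expression
  \<open>(n choose d) * \<alpha> n\<close> of the theorem.

  If this expression is \<open>o(n)\<close>, then a given block is isolated with probability tending to 1. A detecting
  estimate has a large overlap with one group compared to another. The second moment of this difference
  splits into pairs of nodes; pairs in different blocks contribute only if the first block is not
  isolated, so the second moment is \<open>o(n\<^sup>2)\<close>, while detection requires order \<open>n\<^sup>2\<close>
  (\<open>detection_bound\<close>).

  If it is \<open>O(n)\<close>, then a constant fraction of the blocks is isolated on average, and each of them is
  misclassified with probability at least \<open>1 / 2\<close>. Half of the blocks are kept fixed. They determine the
  permutation of the labels in the error, so that correctness of a block makes sense
  (\<open>exists_relabeling\<close>, \<open>weak_consistency_bound\<close>).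

  If it is \<open>o(n log n)\<close>, then the isolation probability may tend to 0, but it is at least \<open>1 / sqrt n\<close>
  eventually. As the
  number of blocks is linear, the second moment method yields an isolated block with high
  probability (\<open>prob_no_isolated_block\<close>), and a wrong guess on this single block rules out exact recovery
  (\<open>strong_consistency_bound\<close>).
\<close>

section \<open>Blocks of nodes and cyclic shifts of their labels\<close>

text \<open>The hidden partition is drawn at random from labelings that are built from blocks of \<open>k\<close> consecutive
  nodes, each of which carries every label exactly once. The nodes beyond the last complete block
  follow the same formula, so that the sizes of any two groups differ by at most one.\<close>

definition block :: "nat \<Rightarrow> nat \<Rightarrow> nat set" where
  "block k b = {k * b + 1..k * b + k}"

definition shifted_labeling :: "nat \<Rightarrow> nat \<Rightarrow> (nat \<Rightarrow> nat) \<Rightarrow> nat \<Rightarrow> nat" where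
  "shifted_labeling n k r = (\<lambda>v\<in>{1..n}. Suc ((v - 1 + r ((v - 1) div k)) mod k))"

text \<open>A block that keeps the shift 0 has known labels and can serve as a reference for the free blocks.\<close>

definition shifts :: "nat \<Rightarrow> nat \<Rightarrow> (nat \<Rightarrow> nat) set" where
  "shifts m k = PiE_dflt {..<m} 0 (\<lambda>_. {..<k})"

lemma block_iff:
  assumes "k > 0"
  shows "v \<in> block k b \<longleftrightarrow> 1 \<le> v \<and> (v - 1) div k = b"
proof (cases v)
  case (Suc u)
  have "u div k = b \<longleftrightarrow> k * b \<le> u \<and> u < k * b + k"
  proof
    assume "u div k = b"
    thus "k * b \<le> u \<and> u < k * b + k"
      using dividend_less_times_div[OF assms, of u] times_div_less_eq_dividend[of k u] by simp
  next
    assume "k * b \<le> u \<and> u < k * b + k"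
    thus "u div k = b" by (intro div_nat_eqI) (simp_all add: mult.commute)
  qed
  with Suc show ?thesis
    unfolding block_def by simp linarith
qed (simp add: block_def)

lemma finite_block [simp]: "finite (block k b)" and card_block [simp]: "card (block k b) = k"
  by (simp_all add: block_def)

lemma block_subset:
  assumes "b < n div k"
  shows "block k b \<subseteq> {1..n}"
proof -
  have "k * b + k \<le> k * (n div k)"
    using mult_le_mono2[of "Suc b" "n div k" k] assms by simp
  also have "\<dots> \<le> n" by simp
  finally show ?thesis by (auto simp: block_def)
qed

lemma div_less_iff_le_mult:
  assumes "k > 0" "1 \<le> (v::nat)"
  shows "(v - 1) div k < m \<longleftrightarrow> v \<le> k * m"
  using assms by (auto simp: div_less_iff_less_mult mult.commute)

lemma mod_shift_inj:
  fixes x c c' k :: nat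
  assumes "(x + c) mod k = (x + c') mod k" "c < k" "c' < k"
  shows "c = c'"
  using assms
proof (induction c c' rule: linorder_wlog)
  case (le c c')
  hence "(x + c') mod k = (x + c) mod k" "x + c \<le> x + c'" by simp_all
  hence "k dvd (x + c') - (x + c)"
    using mod_eq_dvd_iff_nat by blast
  hence "k dvd c' - c" by simp
  moreover have "c' - c < k" using le by simp
  ultimately have "c' - c = 0" by (meson bot_nat_0.not_eq_extremum nat_dvd_not_less)
  with le show ?case by simp
qed simp

lemma finite_shifts [simp]: "finite (shifts m k)"
  by (auto simp: shifts_def)

lemma shifts_nonempty: "k > 0 \<Longrightarrow> shifts m k \<noteq> {}"
  by (auto simp: shifts_def)

lemma shifts_upd: "r \<in> shifts m k \<Longrightarrow> b < m \<Longrightarrow> c < k \<Longrightarrow> r(b := c) \<in> shifts m k"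
  by (auto simp: shifts_def PiE_dflt_def)

lemma shifts_less: "r \<in> shifts m k \<Longrightarrow> k > 0 \<Longrightarrow> r b < k"
  by (cases "b < m") (auto simp: shifts_def PiE_dflt_def)

lemma shifts_outside: "r \<in> shifts m k \<Longrightarrow> m \<le> b \<Longrightarrow> r b = 0"
  by (auto simp: shifts_def PiE_dflt_def)

text \<open>Redrawing the shift of one free block does not change the uniform distribution, because
  exchanging the old shift with the new one is an involution on pairs of a family of shifts and a
  fresh shift.\<close>

lemma sum_shifts_resample:
  fixes h :: "(nat \<Rightarrow> nat) \<Rightarrow> real"
  assumes "b < m" "k > 0"
  shows "(\<Sum>r\<in>shifts m k. \<Sum>c<k. h (r(b := c))) = real k * (\<Sum>r\<in>shifts m k. h r)"
proof -
  let ?f = "\<lambda>(r, c). (r(b := c), r b)"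
  have "(\<Sum>r\<in>shifts m k. \<Sum>c<k. h (r(b := c)))
      = (\<Sum>(r, c)\<in>shifts m k \<times> {..<k}. h (r(b := c)))"
    by (simp add: sum.cartesian_product)
  also have "\<dots> = (\<Sum>(r, c)\<in>shifts m k \<times> {..<k}. h r)"
    by (rule sum.reindex_bij_witness[where i = ?f and j = ?f])
       (use assms in \<open>auto simp: shifts_upd shifts_less\<close>)
  also have "\<dots> = real k * (\<Sum>r\<in>shifts m k. h r)"
    by (simp add: sum.cartesian_product[symmetric] sum_distrib_left)
  finally show ?thesis .
qed

lemma shifted_labeling_eq:
  assumes "b < n div k" "v \<in> block k b" "k > 0"
  shows "shifted_labeling n k r v = Suc ((v - 1 + r b) mod k)"
proof -
  have "v \<in> {1..n}" using assms(2) block_subset[OF assms(1)] by blast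
  moreover have "(v - 1) div k = b" using assms(2,3) by (simp add: block_iff)
  ultimately show ?thesis by (simp add: shifted_labeling_def)
qed

lemma shifted_labeling_upd_other:
  assumes "v \<notin> block k b" "k > 0"
  shows "shifted_labeling n k (r(b := c)) v = shifted_labeling n k r v"
  using assms by (auto simp: shifted_labeling_def block_iff)

lemma shifted_labeling_in_labelings: "k > 0 \<Longrightarrow> shifted_labeling n k r \<in> labelings n k"
  by (auto simp: shifted_labeling_def labelings_def Suc_le_eq)

lemma shifted_labeling_inj_block:
  assumes "k > 0" "u \<in> {1..n}" "v \<in> {1..n}" "(u - 1) div k = (v - 1) div k"
    "shifted_labeling n k r u = shifted_labeling n k r v"
  shows "u = v"
proof -
  have "(r ((v - 1) div k) + (u - 1)) mod k = (r ((v - 1) div k) + (v - 1)) mod k"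
    using assms by (simp add: shifted_labeling_def add.commute)
  hence "(r ((v - 1) div k) + (u - 1) mod k) mod k = (r ((v - 1) div k) + (v - 1) mod k) mod k"
    by (simp add: mod_add_right_eq)
  hence "(u - 1) mod k = (v - 1) mod k"
    using assms(1) by (auto dest!: mod_shift_inj)
  with assms(4) have "u - 1 = v - 1"
    by (metis div_mult_mod_eq)
  with assms(2,3) show ?thesis by auto
qed

lemma bij_betw_shifted_labeling:
  assumes "b < n div k" "k > 0"
  shows "bij_betw (shifted_labeling n k r) (block k b) {1..k}"
proof -
  have inj: "inj_on (shifted_labeling n k r) (block k b)"
  proof (rule inj_onI)
    fix u v assume uv: "u \<in> block k b" "v \<in> block k b"
      "shifted_labeling n k r u = shifted_labeling n k r v"
    have sub: "block k b \<subseteq> {1..n}" by (rule block_subset[OF assms(1)])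
    have eq: "(u - 1) div k = (v - 1) div k"
      using uv(1,2) assms(2) by (simp add: block_iff)
    show "u = v"
      by (rule shifted_labeling_inj_block[OF assms(2) _ _ eq uv(3)])
         (rule subsetD[OF sub] uv)+
  qed
  moreover have "shifted_labeling n k r ` block k b \<subseteq> {1..k}"
    using assms by (auto simp: shifted_labeling_eq[OF assms(1) _ assms(2)] Suc_le_eq)
  hence "shifted_labeling n k r ` block k b = {1..k}"
    by (rule card_subset_eq[rotated]) (simp_all add: card_image[OF inj])
  ultimately show ?thesis by (simp add: bij_betw_def)
qed

text \<open>A uniformly shifted block therefore gives each of its nodes a uniformly distributed label.\<close>

lemma bij_betw_label_of_shift:
  assumes "b < n div k" "v \<in> block k b" "k > 0"
  shows "bij_betw (\<lambda>c. shifted_labeling n k (r(b := c)) v) {..<k} {1..k}"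
proof -
  have inj: "inj_on (\<lambda>c. shifted_labeling n k (r(b := c)) v) {..<k}"
    by (auto simp: inj_on_def shifted_labeling_eq[OF assms] dest: mod_shift_inj)
  moreover have "(\<lambda>c. shifted_labeling n k (r(b := c)) v) ` {..<k} \<subseteq> {1..k}"
    using assms(3) by (auto simp: shifted_labeling_eq[OF assms] Suc_le_eq)
  hence "(\<lambda>c. shifted_labeling n k (r(b := c)) v) ` {..<k} = {1..k}"
    by (rule card_subset_eq[rotated]) (simp_all add: card_image[OF inj])
  ultimately show ?thesis by (simp add: bij_betw_def)
qed

lemma sum_of_bool_label:
  assumes "b < n div k" "v \<in> block k b" "k > 0" "i \<in> {1..k}"
  shows "(\<Sum>c<k. of_bool (shifted_labeling n k (r(b := c)) v = i) :: real) = 1"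
proof -
  let ?f = "\<lambda>c. shifted_labeling n k (r(b := c)) v"
  have bij: "bij_betw ?f {..<k} {1..k}"
    using assms(1-3) by (rule bij_betw_label_of_shift)
  have "(\<Sum>c<k. of_bool (?f c = i) :: real) = (\<Sum>j\<in>?f ` {..<k}. of_bool (j = i))"
    by (subst sum.reindex[OF bij_betw_imp_inj_on[OF bij]]) simp
  also have "?f ` {..<k} = {1..k}"
    using bij by (rule bij_betw_imp_surj_on)
  also have "(\<Sum>j\<in>{1..k}. of_bool (j = i) :: real) = 1"
    using assms(4) by (simp add: of_bool_def)
  finally show ?thesis .
qed

text \<open>Two different shifts give the first node of a block different labels, so one guess of the labels on
  the block can be right for at most one of the \<open>k\<close> shifts.\<close>

lemma sum_of_bool_agree_le_1:
  assumes "b < n div k" "k > 0"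
    and "\<And>c. P c \<Longrightarrow> \<forall>v\<in>block k b. shifted_labeling n k (r(b := c)) v = \<phi> v"
  shows "(\<Sum>c<k. of_bool (P c) :: real) \<le> 1"
proof -
  define v where "v = k * b + 1"
  have v: "v \<in> block k b" using assms(2) by (simp add: block_def v_def)
  have "card {c\<in>{..<k}. P c} \<le> Suc 0"
  proof (subst card_le_Suc0_iff_eq, simp, intro ballI)
    fix c c' assume cc: "c \<in> {c\<in>{..<k}. P c}" "c' \<in> {c\<in>{..<k}. P c}"
    hence "shifted_labeling n k (r(b := c)) v = shifted_labeling n k (r(b := c')) v"
      using assms(3) v by force
    thus "c = c'"
      using cc bij_betw_imp_inj_on[OF bij_betw_label_of_shift[OF assms(1) v assms(2)]]
      by (auto dest: inj_onD)
  qed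
  moreover have "(\<Sum>c<k. of_bool (P c) :: real) = real (card {c\<in>{..<k}. P c})"
    by (simp add: of_bool_def sum.If_cases Int_def)
  ultimately show ?thesis by simp
qed

text \<open>A node with label \<open>i\<close> is determined by its block, and every complete block contains one.\<close>

lemma card_label_in_blocks:
  assumes "k > 0" "i \<in> {1..k}" "m \<le> M" "M \<le> n div k"
  shows "card {v\<in>{k * m + 1..k * M}. shifted_labeling n k r v = i} = M - m"
proof -
  let ?A = "{v\<in>{k * m + 1..k * M}. shifted_labeling n k r v = i}"
  have le: "k * M \<le> n"
    using mult_le_mono2[OF assms(4), of k] times_div_less_eq_dividend[of k n] by linarith
  have "inj_on (\<lambda>v. (v - 1) div k) ?A"
  proof (rule inj_onI)
    fix u v assume "u \<in> ?A" "v \<in> ?A" "(u - 1) div k = (v - 1) div k"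
    thus "u = v" using le by (intro shifted_labeling_inj_block[OF assms(1), of u n v r]) auto
  qed
  moreover have "(\<lambda>v. (v - 1) div k) ` ?A = {m..<M}"
  proof (intro equalityI subsetI)
    fix b assume b: "b \<in> {m..<M}"
    hence "b < n div k" using assms(4) by auto
    hence "i \<in> shifted_labeling n k r ` block k b"
      using bij_betw_imp_surj_on[OF bij_betw_shifted_labeling] assms(1,2) by simp
    then obtain v where v: "v \<in> block k b" "shifted_labeling n k r v = i" by blast
    have v': "1 \<le> v" "(v - 1) div k = b"
      using v(1) assms(1) by (simp_all add: block_iff)
    hence "v \<le> k * M" "\<not> v \<le> k * m"
      using b div_less_iff_le_mult[OF assms(1) v'(1), of m]
        div_less_iff_le_mult[OF assms(1) v'(1), of M] by simp_all
    hence "v \<in> ?A" using v(2) by simp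
    thus "b \<in> (\<lambda>v. (v - 1) div k) ` ?A"
      using v'(2) by (intro image_eqI[of _ _ v]) simp_all
  next
    fix b assume "b \<in> (\<lambda>v. (v - 1) div k) ` ?A"
    then obtain v where v: "v \<in> ?A" "b = (v - 1) div k" by auto
    hence v1: "1 \<le> v" by simp
    show "b \<in> {m..<M}"
      using v div_less_iff_le_mult[OF assms(1) v1, of m]
        div_less_iff_le_mult[OF assms(1) v1, of M] by simp
  qed
  ultimately show ?thesis
    using card_image[of "\<lambda>v. (v - 1) div k" ?A] by simp
qed

text \<open>The incomplete last block contains every label at most once, which accounts for the additional 1.\<close>

lemma group_of_shifted_labeling_split:
  assumes "k > 0" "i \<in> {1..k}"
  shows "card (group_of n (shifted_labeling n k r) i \<inter> S) \<le>
      Suc (card ({v\<in>{1..k * (n div k)}. shifted_labeling n k r v = i} \<inter> S))"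
proof -
  let ?\<psi> = "shifted_labeling n k r" and ?B = "n div k"
  have le: "k * ?B \<le> n" by simp
  let ?R = "{v\<in>{k * ?B + 1..n}. ?\<psi> v = i}"
  have "inj_on (\<lambda>v. (v - 1) div k) ?R"
  proof (rule inj_onI)
    fix u v assume "u \<in> ?R" "v \<in> ?R" "(u - 1) div k = (v - 1) div k"
    thus "u = v" by (intro shifted_labeling_inj_block[OF assms(1), of u n v r]) auto
  qed
  moreover have "(\<lambda>v. (v - 1) div k) ` ?R \<subseteq> {?B}"
  proof
    fix b assume "b \<in> (\<lambda>v. (v - 1) div k) ` ?R"
    then obtain v where v: "v \<in> ?R" "b = (v - 1) div k" by auto
    hence "b \<le> ?B" by (auto intro: div_le_mono)
    moreover have "\<not> b < ?B" using v div_less_iff_le_mult[OF assms(1), of v ?B] by simp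
    ultimately show "b \<in> {?B}" by auto
  qed
  ultimately have R: "card ?R \<le> 1"
    using card_inj_on_le[of "\<lambda>v. (v - 1) div k" ?R "{?B}"] by simp
  have "group_of n ?\<psi> i \<inter> S \<subseteq> ?R \<union> ({v\<in>{1..k * ?B}. ?\<psi> v = i} \<inter> S)"
    by (auto simp: group_of_def)
  hence "card (group_of n ?\<psi> i \<inter> S) \<le> card (?R \<union> ({v\<in>{1..k * ?B}. ?\<psi> v = i} \<inter> S))"
    by (intro card_mono) auto
  also have "\<dots> \<le> card ?R + card ({v\<in>{1..k * ?B}. ?\<psi> v = i} \<inter> S)"
    by (rule card_Un_le)
  finally show ?thesis using R by simp
qed

lemma card_group_of_shifted_labeling:
  assumes "k > 0" "i \<in> {1..k}"
  shows "n div k \<le> card (group_of n (shifted_labeling n k r) i)"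
    and "card (group_of n (shifted_labeling n k r) i) \<le> Suc (n div k)"
proof -
  let ?\<psi> = "shifted_labeling n k r" and ?B = "n div k"
  have c: "card {v\<in>{1..k * ?B}. ?\<psi> v = i} = ?B"
    using card_label_in_blocks[OF assms, of 0 ?B n r] by simp
  have "{v\<in>{1..k * ?B}. ?\<psi> v = i} \<subseteq> group_of n ?\<psi> i"
  proof
    fix v assume "v \<in> {v\<in>{1..k * ?B}. ?\<psi> v = i}"
    moreover have "k * ?B \<le> n" by simp
    ultimately show "v \<in> group_of n ?\<psi> i"
      unfolding group_of_def by (simp del: times_div_less_eq_dividend)
  qed
  from card_mono[OF _ this] c show "?B \<le> card (group_of n ?\<psi> i)"
    by (simp add: group_of_def)
  show "card (group_of n ?\<psi> i) \<le> Suc ?B"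
    using group_of_shifted_labeling_split[OF assms, of n r UNIV] c by simp
qed

lemma admissible_shifted_labeling:
  assumes "k > 0" "real (Suc (n div k)) \<le> C * real (n div k)" "C \<ge> 0"
  shows "admissible C k n (shifted_labeling n k r)"
  unfolding admissible_def
proof (intro conjI ballI)
  fix i j assume "i \<in> {1..k}" "j \<in> {1..k}"
  hence "real (card (group_of n (shifted_labeling n k r) i)) \<le> real (Suc (n div k))"
    "real (n div k) \<le> real (card (group_of n (shifted_labeling n k r) j))"
    using card_group_of_shifted_labeling[OF assms(1)] by (auto simp del: of_nat_Suc)
  thus "real (card (group_of n (shifted_labeling n k r) i))
      \<le> C * real (card (group_of n (shifted_labeling n k r) j))"
    using assms(2,3) by (meson mult_left_mono order_trans)
qed (use assms in \<open>simp add: shifted_labeling_in_labelings\<close>)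

section \<open>Isolated sets of nodes\<close>

definition isolated :: "nat \<Rightarrow> nat \<Rightarrow> (nat set \<Rightarrow> bool) \<Rightarrow> nat set \<Rightarrow> bool" where
  "isolated d n w U \<longleftrightarrow> (\<forall>e\<in>nsets {1..n} d. e \<inter> U \<noteq> {} \<longrightarrow> \<not> w e)"

definition touching :: "nat \<Rightarrow> nat \<Rightarrow> nat set \<Rightarrow> nat set set" where
  "touching d n U = {e\<in>nsets {1..n} d. e \<inter> U \<noteq> {}}"

lemma finite_nsets_atLeastAtMost [simp]: "finite (nsets {a..b::nat} d)"
  by (simp add: finite_imp_finite_nsets)

lemma finite_touching [simp]: "finite (touching d n U)"
  by (simp add: touching_def)

lemma image_in_nsets:
  assumes "\<sigma> permutes A" "e \<in> nsets A d"
  shows "\<sigma> ` e \<in> nsets A d"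
proof -
  have "\<sigma> ` e \<subseteq> A"
    using permutes_image[OF assms(1)] assms(2) by (auto simp: nsets_def)
  moreover have "inj_on \<sigma> e"
    using permutes_inj[OF assms(1)] by (rule inj_on_subset) simp
  ultimately show ?thesis
    using assms(2) by (simp add: nsets_def card_image)
qed

text \<open>A permutation of the nodes maps edges to edges and carries homogeneous edges of \<open>\<Psi> \<circ> \<sigma>\<close> to
  homogeneous edges of \<open>\<Psi>\<close>. Weights that do not change under the permutation are thus equally likely
  under both labelings.\<close>

lemma pmf_sbm_permute:
  assumes \<sigma>: "\<sigma> permutes {1..n}"
    and w: "\<And>e. e \<in> nsets {1..n} d \<Longrightarrow> w (\<sigma> ` e) = w e"
  shows "pmf (sbm_pmf d p q a n (\<Psi> \<circ> \<sigma>)) w = pmf (sbm_pmf d p q a n \<Psi>) w"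
proof -
  let ?E = "nsets {1..n} d"
  let ?t = "\<lambda>\<Psi> e. pmf (if \<Psi> constant_on e then bernoulli_pmf (p * a)
                        else bernoulli_pmf (q * a)) (w e)"
  have inj: "inj \<sigma>" using \<sigma> by (rule permutes_inj)
  have inj': "inj_on ((`) \<sigma>) ?E"
    using inj by (auto simp: inj_on_def inj_image_eq_iff)
  have "(`) \<sigma> ` ?E \<subseteq> ?E"
    using image_in_nsets[OF \<sigma>] by blast
  hence "(`) \<sigma> ` ?E = ?E"
    using card_image[OF inj'] by (intro card_subset_eq) auto
  with inj' have bij: "bij_betw ((`) \<sigma>) ?E ?E"
    by (simp add: bij_betw_def)
  have "(\<Prod>e\<in>?E. ?t (\<Psi> \<circ> \<sigma>) e) = (\<Prod>e\<in>?E. ?t \<Psi> (\<sigma> ` e))"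
    by (intro prod.cong) (auto simp: w constant_on_def)
  also have "\<dots> = (\<Prod>e\<in>?E. ?t \<Psi> e)"
    using prod.reindex_bij_betw[OF bij, of "?t \<Psi>"] .
  finally show ?thesis
    unfolding sbm_pmf_def pmf_Pi[OF finite_nsets_atLeastAtMost] by (simp only:)
qed

text \<open>The source of all lower bounds: the labels can be rearranged within an isolated set without changing
  the likelihood of the weights at all. The rearrangement comes from a permutation of the set, which
  fixes every other edge and moves the edges that meet the set among themselves, where all weights
  are 0.\<close>

lemma pmf_sbm_isolated_swap:
  assumes U: "U \<subseteq> {1..n}" "isolated d n w U"
    and bij: "bij_betw \<Psi> U V" "bij_betw \<Psi>' U V"
    and eq: "\<And>v. v \<notin> U \<Longrightarrow> \<Psi>' v = \<Psi> v"
  shows "pmf (sbm_pmf d p q a n \<Psi>') w = pmf (sbm_pmf d p q a n \<Psi>) w"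
proof -
  define \<sigma> where "\<sigma> v = (if v \<in> U then inv_into U \<Psi> (\<Psi>' v) else v)" for v
  have "bij_betw (inv_into U \<Psi> \<circ> \<Psi>') U U"
    using bij(2) bij_betw_inv_into[OF bij(1)] by (rule bij_betw_trans)
  hence "bij_betw \<sigma> U U"
    by (rule bij_betw_cong[THEN iffD1, rotated]) (simp add: \<sigma>_def)
  hence \<sigma>U: "\<sigma> permutes U"
    by (rule bij_imp_permutes) (simp add: \<sigma>_def)
  hence \<sigma>: "\<sigma> permutes {1..n}"
    using U(1) by (rule permutes_subset)
  have "\<Psi>' v = (\<Psi> \<circ> \<sigma>) v" for v
  proof (cases "v \<in> U")
    case True
    hence "\<Psi>' v \<in> \<Psi> ` U" using bij by (auto simp: bij_betw_def)
    thus ?thesis using True by (simp add: \<sigma>_def f_inv_into_f)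
  qed (simp add: \<sigma>_def eq)
  hence \<Psi>': "\<Psi>' = \<Psi> \<circ> \<sigma>" by auto
  have "w (\<sigma> ` e) = w e" if e: "e \<in> nsets {1..n} d" for e
  proof (cases "e \<inter> U = {}")
    case True
    hence "\<sigma> x = x" if "x \<in> e" for x using that by (auto simp: \<sigma>_def)
    hence "\<sigma> ` e = e" by simp
    thus ?thesis by simp
  next
    case False
    have "\<sigma> ` e \<in> nsets {1..n} d"
      using \<sigma> e by (rule image_in_nsets)
    moreover have "\<sigma> ` e \<inter> U \<noteq> {}"
    proof -
      from False obtain x where "x \<in> e" "x \<in> U" by blast
      moreover from this have "\<sigma> x \<in> U" using permutes_in_image[OF \<sigma>U] by simp
      ultimately show ?thesis by blast
    qed
    ultimately have "\<not> w (\<sigma> ` e)" "\<not> w e"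
      using U(2) e False unfolding isolated_def by (metis, metis)
    thus ?thesis by simp
  qed
  hence "pmf (sbm_pmf d p q a n (\<Psi> \<circ> \<sigma>)) w = pmf (sbm_pmf d p q a n \<Psi>) w"
    by (rule pmf_sbm_permute[OF \<sigma>])
  thus ?thesis using \<Psi>' by simp
qed

lemma pmf_sbm_shift_isolated:
  assumes "b < n div k" "k > 0" "isolated d n w (block k b)"
  shows "pmf (sbm_pmf d p q a n (shifted_labeling n k (r(b := c)))) w =
    pmf (sbm_pmf d p q a n (shifted_labeling n k r)) w"
proof (rule pmf_sbm_isolated_swap)
  show "block k b \<subseteq> {1..n}" using assms(1) by (rule block_subset)
  show "shifted_labeling n k (r(b := c)) v = shifted_labeling n k r v" if "v \<notin> block k b" for v
    using that assms(2) by (rule shifted_labeling_upd_other)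
qed (use assms bij_betw_shifted_labeling in auto)

section \<open>Probability of isolation\<close>

lemma prob_sbm_no_edge:
  assumes "T \<subseteq> nsets {1..n} d" "0 \<le> q" "q \<le> p" "0 \<le> a" "p * a \<le> 1"
  shows "measure_pmf.prob (sbm_pmf d p q a n \<Psi>) {w. \<forall>e\<in>T. \<not> w e} =
    (\<Prod>e\<in>T. if \<Psi> constant_on e then 1 - p * a else 1 - q * a)"
proof -
  let ?E = "nsets {1..n} d"
  let ?f = "\<lambda>e. if \<Psi> constant_on e then bernoulli_pmf (p * a) else bernoulli_pmf (q * a)"
  have qa: "0 \<le> q * a" "q * a \<le> 1" "0 \<le> p * a"
    using assms mult_right_mono[of q p a] by auto
  have "{w. \<forall>e\<in>T. \<not> w e} = Pi ?E (\<lambda>e. if e \<in> T then {False} else UNIV)"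
    using assms(1) by (auto simp: Pi_def split: if_splits)
  hence "measure_pmf.prob (sbm_pmf d p q a n \<Psi>) {w. \<forall>e\<in>T. \<not> w e} =
      (\<Prod>e\<in>?E. measure_pmf.prob (?f e) (if e \<in> T then {False} else UNIV))"
    unfolding sbm_pmf_def by (simp only: measure_Pi_pmf_Pi[OF finite_nsets_atLeastAtMost])
  also have "\<dots> = (\<Prod>e\<in>T. measure_pmf.prob (?f e) (if e \<in> T then {False} else UNIV))"
    using assms(1) by (intro prod.mono_neutral_right) auto
  also have "\<dots> = (\<Prod>e\<in>T. if \<Psi> constant_on e then 1 - p * a else 1 - q * a)"
    using qa assms(5) by (intro prod.cong) (auto simp: measure_pmf_single)
  finally show ?thesis .
qed

lemma one_minus_ge_exp:
  fixes x :: real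
  assumes "0 \<le> x" "x \<le> 1 / 2"
  shows "exp (- 2 * x) \<le> 1 - x"
proof -
  have "x * x \<le> x * (1 / 2)"
    using assms by (intro mult_left_mono) auto
  hence "- 2 * x \<le> ln (1 - x)"
    using ln_one_minus_pos_lower_bound[OF assms] by (simp add: power2_eq_square)
  thus ?thesis
    using assms by (simp add: ln_ge_iff)
qed

text \<open>Only the number of edges enters, so the same bound serves for the isolation of one block and for the
  correlation between two blocks.\<close>

lemma no_edge_factors_ge_exp:
  fixes p q a :: real
  assumes "finite T" "real (card T) \<le> N" "0 \<le> q" "q \<le> p" "0 \<le> a" "p * a \<le> 1 / 2"
  shows "exp (- 2 * p * a * N) \<le> (\<Prod>e\<in>T. if \<Psi> constant_on e then 1 - p * a else 1 - q * a)"
proof -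
  have qa: "q * a \<le> p * a" "0 \<le> p * a"
    using assms by (auto intro: mult_right_mono)
  have "(p * a) * real (card T) \<le> (p * a) * N"
    using assms(2) qa(2) by (rule mult_left_mono)
  hence "exp (- 2 * p * a * N) \<le> exp (- 2 * (p * a)) ^ card T"
    by (simp add: exp_of_nat_mult[symmetric] algebra_simps)
  also have "\<dots> \<le> (1 - p * a) ^ card T"
    using qa(2) assms(6) by (intro power_mono one_minus_ge_exp) auto
  also have "\<dots> = (\<Prod>e\<in>T. 1 - p * a)" by simp
  also have "\<dots> \<le> (\<Prod>e\<in>T. if \<Psi> constant_on e then 1 - p * a else 1 - q * a)"
    using qa assms(6) by (intro prod_mono) auto
  finally show ?thesis .
qed

lemma card_edges_containing:
  assumes "finite A" "U \<subseteq> A"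
  shows "card {e\<in>nsets A d. U \<subseteq> e} \<le> (card A - card U) choose (d - card U)"
proof -
  have fU: "finite U" using assms by (rule finite_subset[rotated])
  have "inj_on (\<lambda>e. e - U) {e\<in>nsets A d. U \<subseteq> e}"
    by (auto simp: inj_on_def)
  moreover have "(\<lambda>e. e - U) ` {e\<in>nsets A d. U \<subseteq> e} \<subseteq> {B. B \<subseteq> A - U \<and> card B = d - card U}"
    using fU by (auto simp: nsets_def card_Diff_subset)
  moreover have "finite {B. B \<subseteq> A - U \<and> card B = d - card U}"
    using assms(1) by simp
  ultimately have "card {e\<in>nsets A d. U \<subseteq> e} \<le> card {B. B \<subseteq> A - U \<and> card B = d - card U}"
    by (rule card_inj_on_le)
  also have "\<dots> = (card A - card U) choose (d - card U)"
    using assms fU by (simp add: n_subsets card_Diff_subset)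
  finally show ?thesis .
qed

lemma card_touching_block:
  assumes "b < n div k"
  shows "card (touching d n (block k b)) \<le> k * ((n - 1) choose (d - 1))"
proof -
  have sub: "block k b \<subseteq> {1..n}" using assms by (rule block_subset)
  have "touching d n (block k b) \<subseteq> (\<Union>v\<in>block k b. {e\<in>nsets {1..n} d. {v} \<subseteq> e})"
    by (auto simp: touching_def)
  hence "card (touching d n (block k b)) \<le> card (\<Union>v\<in>block k b. {e\<in>nsets {1..n} d. {v} \<subseteq> e})"
    by (intro card_mono) auto
  also have "\<dots> \<le> (\<Sum>v\<in>block k b. card {e\<in>nsets {1..n} d. {v} \<subseteq> e})"
    by (rule card_UN_le) simp
  also have "\<dots> \<le> (\<Sum>v\<in>block k b. (n - 1) choose (d - 1))"
  proof (rule sum_mono)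
    fix v assume "v \<in> block k b"
    thus "card {e\<in>nsets {1..n} d. {v} \<subseteq> e} \<le> (n - 1) choose (d - 1)"
      using card_edges_containing[of "{1..n}" "{v}" d] sub by auto
  qed
  finally show ?thesis by simp
qed

text \<open>An edge that meets two disjoint blocks contains one of the \<open>k\<^sup>2\<close> pairs of nodes.\<close>

lemma card_touching_two_blocks:
  assumes "b < n div k" "b' < n div k" "b \<noteq> b'"
  shows "card (touching d n (block k b) \<inter> touching d n (block k b'))
    \<le> k\<^sup>2 * ((n - 2) choose (d - 2))"
proof -
  let ?T = "touching d n (block k b) \<inter> touching d n (block k b')"
  let ?f = "\<lambda>(u, v). {e\<in>nsets {1..n} d. {u, v} \<subseteq> e}"
  have sub: "block k b \<subseteq> {1..n}" "block k b' \<subseteq> {1..n}"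
    using block_subset assms(1,2) by blast+
  have disj: "u \<noteq> v" if "u \<in> block k b" "v \<in> block k b'" for u v
  proof -
    have k: "k > 0" using that(1) by (auto simp: block_def)
    show ?thesis using that assms(3) by (auto simp: block_iff[OF k])
  qed
  have "?T \<subseteq> (\<Union>x\<in>block k b \<times> block k b'. ?f x)"
    by (auto simp: touching_def)
  hence "card ?T \<le> card (\<Union>x\<in>block k b \<times> block k b'. ?f x)"
    by (intro card_mono) auto
  also have "\<dots> \<le> (\<Sum>x\<in>block k b \<times> block k b'. card (?f x))"
    by (rule card_UN_le) simp
  also have "\<dots> \<le> (\<Sum>x\<in>block k b \<times> block k b'. (n - 2) choose (d - 2))"
  proof (rule sum_mono)
    fix x assume x: "x \<in> block k b \<times> block k b'"
    obtain u v where uv: "x = (u, v)" by (cases x)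
    have "card {u, v} = 2" "{u, v} \<subseteq> {1..n}"
      using x uv disj[of u v] sub by auto
    thus "card (?f x) \<le> (n - 2) choose (d - 2)"
      using card_edges_containing[of "{1..n}" "{u, v}" d] uv by simp
  qed
  finally show ?thesis by (simp add: power2_eq_square card_cartesian_product)
qed

section \<open>Averaging over the shifts\<close>

lemma prob_as_expectation:
  "measure_pmf.prob M {x. P x} = measure_pmf.expectation M (\<lambda>x. of_bool (P x) :: real)"
proof -
  have "measure_pmf.prob M {x. P x} = measure_pmf.expectation M (indicator {x. P x})"
    by simp
  also have "indicator {x. P x} = (\<lambda>x. of_bool (P x) :: real)"
    by (auto simp: fun_eq_iff)
  finally show ?thesis .
qed

text \<open>The model for one value of \<open>n\<close>, with \<open>a\<close> the value of the scaling sequence and \<open>K\<close> the kernel of the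
  estimator. The bound on \<open>p * a\<close> makes \<open>1 - x \<ge> exp (- 2 * x)\<close> available for the edge probabilities.\<close>

locale shifted_model =
  fixes d k n m :: nat and p q a :: real
    and K :: "(nat set \<Rightarrow> bool) \<Rightarrow> (nat \<Rightarrow> nat) pmf"
  assumes k_ge_2: "2 \<le> k" and m_le: "m \<le> n div k"
    and q_nonneg: "0 \<le> q" and q_le_p: "q \<le> p" and a_nonneg: "0 \<le> a" and pa_le: "p * a \<le> 1 / 2"
    and finite_K: "\<And>w. finite (set_pmf (K w))"
begin

abbreviation law :: "(nat \<Rightarrow> nat) \<Rightarrow> (nat set \<Rightarrow> bool) pmf" where
  "law r \<equiv> sbm_pmf d p q a n (shifted_labeling n k r)"

abbreviation outcome :: "(nat \<Rightarrow> nat) \<Rightarrow> (nat \<Rightarrow> nat) pmf" where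
  "outcome r \<equiv> bind_pmf (law r) K"

text \<open>At most \<open>k * ((n - 1) choose (d - 1))\<close> edges meet a block, so this bounds the probability from below
  that a block is isolated.\<close>

definition isolation_bound :: real where
  "isolation_bound = exp (- 2 * p * a * real (k * ((n - 1) choose (d - 1))))"

lemma k_pos: "k > 0"
  using k_ge_2 by simp

definition weights :: "(nat set \<Rightarrow> bool) set" where
  "weights = PiE_dflt (nsets {1..n} d) False (\<lambda>_. UNIV)"

lemma finite_weights: "finite weights"
  unfolding weights_def by (rule finite_PiE_dflt) simp_all

lemma set_law: "set_pmf (law r) \<subseteq> weights"
  unfolding sbm_pmf_def weights_def
  by (rule order.trans[OF set_Pi_pmf_subset'[OF finite_nsets_atLeastAtMost]])
     (auto simp: PiE_dflt_def)

lemma integrable_K: "integrable (measure_pmf (K w)) (f :: _ \<Rightarrow> real)"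
  by (rule integrable_measure_pmf_finite[OF finite_K])

lemma finite_outcome: "finite (set_pmf (outcome r))"
  using finite_subset[OF set_law finite_weights] finite_K by auto

lemma integrable_outcome: "integrable (measure_pmf (outcome r)) (f :: _ \<Rightarrow> real)"
  by (rule integrable_measure_pmf_finite[OF finite_outcome])

lemma expectation_outcome:
  fixes f :: "_ \<Rightarrow> real"
  shows "measure_pmf.expectation (outcome r) f =
    (\<Sum>w\<in>weights. pmf (law r) w * measure_pmf.expectation (K w) f)"
  using pmf_expectation_bind[OF finite_weights finite_K set_law, where h = f] by simp

lemma prob_law:
  "measure_pmf.prob (law r) A = (\<Sum>w\<in>weights. pmf (law r) w * indicator A w)"
proof -
  have "measure_pmf.prob (law r) A = measure_pmf.expectation (law r) (indicator A)"
    by simp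
  also have "\<dots> = (\<Sum>w\<in>weights. indicator A w * pmf (law r) w)"
    by (rule integral_measure_pmf_real[OF finite_weights]) (use set_law in blast)
  finally show ?thesis by (simp add: mult.commute)
qed

text \<open>Given weights under which a free block is isolated, all \<open>k\<close> shifts of this block have the same
  posterior probability, whatever the other shifts are. If \<open>F\<close>, summed over these shifts, is at most
  \<open>\<kappa>\<close>, then its conditional mean is at most \<open>\<kappa> / k\<close>; outside \<open>A\<close> the bound 1 is used. The isolated
  block \<open>\<beta> w\<close> may depend on the weights, but not on the shifts.\<close>

lemma averaging:
  fixes F :: "(nat \<Rightarrow> nat) \<Rightarrow> (nat \<Rightarrow> nat) \<Rightarrow> real"
  assumes iso: "\<And>w. w \<in> A \<Longrightarrow> \<beta> w < m \<and> isolated d n w (block k (\<beta> w))"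
    and F: "\<And>r \<phi>. r \<in> shifts m k \<Longrightarrow> F r \<phi> \<le> 1"
    and \<kappa>: "\<And>w r \<phi>. w \<in> A \<Longrightarrow> r \<in> shifts m k \<Longrightarrow> (\<Sum>c<k. F (r(\<beta> w := c)) \<phi>) \<le> \<kappa>"
    and "0 \<le> \<kappa>"
  shows "(\<Sum>r\<in>shifts m k. measure_pmf.expectation (outcome r) (F r)) \<le>
    (\<Sum>r\<in>shifts m k. \<kappa> / k * measure_pmf.prob (law r) A + measure_pmf.prob (law r) (- A))"
proof -
  let ?R = "shifts m k"
  \<comment> \<open>The bound already holds for each single outcome of the weights.\<close>
  have 1: "(\<Sum>r\<in>?R. pmf (law r) w * measure_pmf.expectation (K w) (F r)) \<le>
      (\<Sum>r\<in>?R. pmf (law r) w * (\<kappa> / k * indicator A w + indicator (- A) w))" for w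
  proof (cases "w \<in> A")
    case True
    define b where "b = \<beta> w"
    have b: "b < m" "isolated d n w (block k b)" using iso[OF True] by (auto simp: b_def)
    have bn: "b < n div k" using b(1) m_le by simp
    let ?h = "\<lambda>r. pmf (law r) w * measure_pmf.expectation (K w) (F r)"
    have "real k * (\<Sum>r\<in>?R. ?h r) = (\<Sum>r\<in>?R. \<Sum>c<k. ?h (r(b := c)))"
      by (rule sum_shifts_resample[OF b(1) k_pos, symmetric])
    also have "\<dots> = (\<Sum>r\<in>?R. pmf (law r) w *
        measure_pmf.expectation (K w) (\<lambda>\<phi>. \<Sum>c<k. F (r(b := c)) \<phi>))"
      by (simp add: pmf_sbm_shift_isolated[OF bn k_pos b(2)] sum_distrib_left
            Bochner_Integration.integral_sum integrable_K)
    also have "\<dots> \<le> (\<Sum>r\<in>?R. pmf (law r) w * \<kappa>)"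
    proof (intro sum_mono mult_left_mono pmf_nonneg)
      fix r assume "r \<in> ?R"
      hence "measure_pmf.expectation (K w) (\<lambda>\<phi>. \<Sum>c<k. F (r(b := c)) \<phi>)
          \<le> measure_pmf.expectation (K w) (\<lambda>_. \<kappa>)"
        unfolding b_def using \<kappa>[OF True] by (intro integral_mono integrable_K) auto
      thus "measure_pmf.expectation (K w) (\<lambda>\<phi>. \<Sum>c<k. F (r(b := c)) \<phi>) \<le> \<kappa>" by simp
    qed
    finally have "(\<Sum>r\<in>?R. ?h r) \<le> (\<Sum>r\<in>?R. pmf (law r) w * \<kappa>) / k"
      using k_pos by (simp add: field_simps)
    with True show ?thesis by (simp add: sum_divide_distrib)
  next
    case False
    show ?thesis
    proof (intro sum_mono mult_left_mono pmf_nonneg)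
      fix r assume "r \<in> ?R"
      hence "measure_pmf.expectation (K w) (F r) \<le> measure_pmf.expectation (K w) (\<lambda>_. 1)"
        using F by (intro integral_mono integrable_K) auto
      thus "measure_pmf.expectation (K w) (F r) \<le> \<kappa> / k * indicator A w + indicator (- A) w"
        using False \<open>0 \<le> \<kappa>\<close> by (simp add: add_increasing)
    qed
  qed
  have 2: "(\<Sum>w\<in>weights. pmf (law r) w * (\<kappa> / k * indicator A w + indicator (- A) w)) =
      \<kappa> / k * measure_pmf.prob (law r) A + measure_pmf.prob (law r) (- A)" for r
    unfolding prob_law[of r A] prob_law[of r "- A"]
    by (simp add: distrib_left sum.distrib sum_distrib_left mult.left_commute del: indicator_compl)
  have "(\<Sum>r\<in>?R. measure_pmf.expectation (outcome r) (F r)) =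
      (\<Sum>w\<in>weights. \<Sum>r\<in>?R. pmf (law r) w * measure_pmf.expectation (K w) (F r))"
    unfolding expectation_outcome by (rule sum.swap)
  also have "\<dots> \<le> (\<Sum>w\<in>weights. \<Sum>r\<in>?R. pmf (law r) w * (\<kappa> / k * indicator A w + indicator (- A) w))"
    by (intro sum_mono 1)
  also have "\<dots> = (\<Sum>r\<in>?R. \<Sum>w\<in>weights. pmf (law r) w * (\<kappa> / k * indicator A w + indicator (- A) w))"
    by (rule sum.swap)
  finally show ?thesis unfolding 2 .
qed

lemma isolated_iff_no_touching_edge:
  "isolated d n w U \<longleftrightarrow> (\<forall>e\<in>touching d n U. \<not> w e)"
  by (auto simp: isolated_def touching_def)

lemma touching_subset: "touching d n U \<subseteq> nsets {1..n} d"
  by (auto simp: touching_def)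

definition no_edge_prob :: "(nat \<Rightarrow> nat) \<Rightarrow> nat set set \<Rightarrow> real" where
  "no_edge_prob r T =
     (\<Prod>e\<in>T. if shifted_labeling n k r constant_on e then 1 - p * a else 1 - q * a)"

lemma pa_le_1: "p * a \<le> 1"
  using pa_le by simp

lemma prob_law_no_edge:
  "T \<subseteq> nsets {1..n} d \<Longrightarrow> measure_pmf.prob (law r) {w. \<forall>e\<in>T. \<not> w e} = no_edge_prob r T"
  unfolding no_edge_prob_def
  by (rule prob_sbm_no_edge[OF _ q_nonneg q_le_p a_nonneg pa_le_1])

lemma prob_isolated_eq:
  "measure_pmf.prob (law r) {w. isolated d n w U} = no_edge_prob r (touching d n U)"
  unfolding isolated_iff_no_touching_edge by (rule prob_law_no_edge[OF touching_subset])

lemma no_edge_prob_touching_ge: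
  assumes "b < n div k"
  shows "isolation_bound \<le> no_edge_prob r (touching d n (block k b))"
proof -
  have "real (card (touching d n (block k b))) \<le> real (k * ((n - 1) choose (d - 1)))"
    using card_touching_block[OF assms] by (simp only: of_nat_le_iff)
  thus ?thesis
    unfolding isolation_bound_def no_edge_prob_def
    by (intro no_edge_factors_ge_exp q_nonneg q_le_p a_nonneg pa_le finite_touching)
qed

lemma prob_isolated_ge:
  assumes "b < n div k"
  shows "isolation_bound \<le> measure_pmf.prob (law r) {w. isolated d n w (block k b)}"
  unfolding prob_isolated_eq by (rule no_edge_prob_touching_ge[OF assms])

text \<open>Bounds on averages over the shifts yield a single hidden partition that is bad for the estimator.\<close>

lemma exists_shift_le:
  fixes f :: "(nat \<Rightarrow> nat) \<Rightarrow> real"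
  assumes "(\<Sum>r\<in>shifts m k. f r) \<le> (\<Sum>r\<in>shifts m k. c)"
  shows "\<exists>r\<in>shifts m k. f r \<le> c"
proof (rule ccontr)
  assume "\<not> ?thesis"
  hence "(\<Sum>r\<in>shifts m k. c) < (\<Sum>r\<in>shifts m k. f r)"
    using shifts_nonempty[OF k_pos] by (intro sum_strict_mono) auto
  with assms show False by simp
qed

lemma isolation_bound_pos: "0 < isolation_bound"
  by (simp add: isolation_bound_def)

lemma isolation_bound_le_1: "isolation_bound \<le> 1"
proof -
  have "- 2 * p * a * x \<le> 0" if "0 \<le> x" for x :: real
  proof -
    have "0 \<le> p * a * x"
      using q_nonneg q_le_p a_nonneg that by (intro mult_nonneg_nonneg) auto
    thus ?thesis by (simp add: mult.assoc)
  qed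
  from this[OF of_nat_0_le_iff] show ?thesis
    unfolding isolation_bound_def exp_le_one_iff .
qed

lemma block_in_nodes: "b < m \<Longrightarrow> block k b \<subseteq> {1..n}"
  using block_subset m_le by simp

section \<open>Anchored partitions\<close>

lemma err_le_imp_permutation:
  fixes \<epsilon> :: real
  assumes "err k n \<Psi> \<phi> \<le> \<epsilon>" "n > 0"
  shows "\<exists>\<pi>. \<pi> permutes {1..k} \<and> real (card {v\<in>{1..n}. \<Psi> v \<noteq> \<pi> (\<phi> v)}) \<le> \<epsilon> * n"
proof -
  let ?P = "{\<pi>. \<pi> permutes {1..k}}" and ?f = "\<lambda>\<pi>. card {v\<in>{1..n}. \<Psi> v \<noteq> \<pi> (\<phi> v)}"
  have "?P \<noteq> {}" using permutes_id by blast
  moreover have "finite ?P" by (rule finite_permutations) simp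
  ultimately have "Min (?f ` ?P) \<in> ?f ` ?P"
    by (intro Min_in) blast+
  then obtain \<pi> where \<pi>: "\<pi> permutes {1..k}" "Min (?f ` ?P) = ?f \<pi>" by auto
  have "real (?f \<pi>) / n \<le> \<epsilon>"
    using assms(1) unfolding err_def \<pi>(2) by simp
  hence "real (?f \<pi>) \<le> \<epsilon> * n"
    using assms(2) by (simp add: field_simps)
  with \<pi>(1) show ?thesis by blast
qed

text \<open>The error is measured up to a permutation of the labels. The blocks from \<open>m\<close> on have the same labels
  for all shifts and anchor this permutation: if a permutation makes few errors, then it is determined
  by its values on the anchored nodes, since two such permutations agree with the known labels at a
  common node of every group. So it is a function of the estimate alone.\<close>

lemma exists_relabeling:
  fixes \<epsilon> :: real
  assumes gap: "2 * \<epsilon> * n < real (n div k) - real m"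
  obtains g where "\<And>r \<phi>. r \<in> shifts m k \<Longrightarrow> err k n (shifted_labeling n k r) \<phi> \<le> \<epsilon> \<Longrightarrow>
      real (card {v\<in>{1..n}. shifted_labeling n k r v \<noteq> g \<phi> v}) \<le> \<epsilon> * n"
proof -
  define B where "B = n div k"
  let ?V = "{k * m + 1..k * B}"
  define anchor where "anchor = shifted_labeling n k (\<lambda>_. 0)"
  define good where "good \<phi> \<pi> \<longleftrightarrow> \<pi> permutes {1..k} \<and>
      real (card {v\<in>?V. anchor v \<noteq> \<pi> (\<phi> v)}) \<le> \<epsilon> * n" for \<phi> \<pi>
  have unique: "\<pi> = \<pi>'" if "good \<phi> \<pi>" "good \<phi> \<pi>'" for \<phi> \<pi> \<pi>'
  proof
    fix x
    have \<pi>: "\<pi> permutes {1..k}" "\<pi>' permutes {1..k}" using that by (auto simp: good_def)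
    show "\<pi> x = \<pi>' x"
    proof (cases "x \<in> {1..k}")
      case True
      hence i: "\<pi> x \<in> {1..k}" using permutes_in_image[OF \<pi>(1)] by blast
      let ?A = "{v\<in>?V. anchor v = \<pi> x}"
      let ?W = "{v\<in>?V. anchor v \<noteq> \<pi> (\<phi> v)}" and ?W' = "{v\<in>?V. anchor v \<noteq> \<pi>' (\<phi> v)}"
      have cA: "card ?A = B - m"
        unfolding anchor_def B_def by (rule card_label_in_blocks[OF k_pos i m_le]) simp
      have cA': "real (card ?A) = real (n div k) - real m"
        unfolding cA unfolding B_def by (rule of_nat_diff[OF m_le])
      have "real (card (?W \<union> ?W')) \<le> real (card ?W + card ?W')"
        by (simp only: of_nat_le_iff card_Un_le)
      also have "\<dots> \<le> 2 * \<epsilon> * n" using that by (simp add: good_def)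
      also have "\<dots> < real (card ?A)" unfolding cA' by (rule gap)
      finally have "card (?W \<union> ?W') < card ?A" by simp
      have "\<not> ?A \<subseteq> ?W \<union> ?W'"
      proof
        assume "?A \<subseteq> ?W \<union> ?W'"
        hence "card ?A \<le> card (?W \<union> ?W')" by (intro card_mono) auto
        with \<open>card (?W \<union> ?W') < card ?A\<close> show False by simp
      qed
      then obtain v where v: "\<pi> (\<phi> v) = \<pi> x" "\<pi>' (\<phi> v) = \<pi> x" by auto
      hence "\<phi> v = x" using permutes_inj[OF \<pi>(1)] by (auto dest: injD)
      with v show ?thesis by simp
    qed (use \<pi> in \<open>simp add: permutes_not_in\<close>)
  qed
  define g where "g \<phi> v = (SOME \<pi>. good \<phi> \<pi>) (\<phi> v)" for \<phi> :: "nat \<Rightarrow> nat" and v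
  show thesis
  proof (rule that)
    fix r \<phi> assume r: "r \<in> shifts m k" and e: "err k n (shifted_labeling n k r) \<phi> \<le> \<epsilon>"
    let ?\<psi> = "shifted_labeling n k r"
    have "n > 0"
    proof (rule ccontr)
      assume "\<not> n > 0"
      with gap show False by simp
    qed
    then obtain \<pi> where \<pi>: "\<pi> permutes {1..k}"
        "real (card {v\<in>{1..n}. ?\<psi> v \<noteq> \<pi> (\<phi> v)}) \<le> \<epsilon> * n"
      using err_le_imp_permutation[OF e] by blast
    have kB: "k * B \<le> n" by (simp add: B_def)
    have "anchor v = ?\<psi> v" if "v \<in> ?V" for v
    proof -
      have "\<not> (v - 1) div k < m" using that div_less_iff_le_mult[OF k_pos, of v m] by simp
      thus ?thesis using shifts_outside[OF r] by (simp add: anchor_def shifted_labeling_def)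
    qed
    hence "{v\<in>?V. anchor v \<noteq> \<pi> (\<phi> v)} \<subseteq> {v\<in>{1..n}. ?\<psi> v \<noteq> \<pi> (\<phi> v)}"
      using kB by auto
    hence "card {v\<in>?V. anchor v \<noteq> \<pi> (\<phi> v)} \<le> card {v\<in>{1..n}. ?\<psi> v \<noteq> \<pi> (\<phi> v)}"
      by (intro card_mono) auto
    hence good: "good \<phi> \<pi>" using \<pi> by (simp add: good_def)
    hence "(SOME \<pi>. good \<phi> \<pi>) = \<pi>" using unique by (intro some_equality) auto
    thus "real (card {v\<in>{1..n}. ?\<psi> v \<noteq> g \<phi> v}) \<le> \<epsilon> * n"
      using \<pi>(2) by (simp add: g_def)
  qed
qed

section \<open>Fraction of misclassified blocks\<close>

text \<open>Each free block with an error contains a misclassified node.\<close>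

lemma correct_blocks:
  assumes "real (card {v\<in>{1..n}. \<Psi> v \<noteq> \<phi> v}) \<le> t"
  shows "real m - t \<le> (\<Sum>b<m. of_bool (\<forall>v\<in>block k b. \<Psi> v = \<phi> v))"
proof -
  let ?C = "{b\<in>{..<m}. \<forall>v\<in>block k b. \<Psi> v = \<phi> v}"
  have "{..<m} - ?C \<subseteq> (\<lambda>v. (v - 1) div k) ` {v\<in>{1..n}. \<Psi> v \<noteq> \<phi> v}"
  proof
    fix b assume b: "b \<in> {..<m} - ?C"
    then obtain v where v: "v \<in> block k b" "\<Psi> v \<noteq> \<phi> v" by auto
    moreover have "v \<in> {1..n}" using b v(1) block_in_nodes[of b] by blast
    moreover have "(v - 1) div k = b" using v(1) by (simp add: block_iff[OF k_pos])
    ultimately show "b \<in> (\<lambda>v. (v - 1) div k) ` {v\<in>{1..n}. \<Psi> v \<noteq> \<phi> v}" by blast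
  qed
  hence "card ({..<m} - ?C) \<le> card {v\<in>{1..n}. \<Psi> v \<noteq> \<phi> v}"
    by (rule surj_card_le[rotated]) simp
  moreover have "card ({..<m} - ?C) = m - card ?C"
    by (subst card_Diff_subset) auto
  ultimately have "real m - real (card ?C) \<le> t" using assms by linarith
  moreover have "(\<Sum>b<m. of_bool (\<forall>v\<in>block k b. \<Psi> v = \<phi> v)) = real (card ?C)"
    by (simp add: of_bool_def sum.If_cases Int_def)
  ultimately show ?thesis by simp
qed

text \<open>An isolated block is labeled correctly with probability at most \<open>1 / k \<le> 1 / 2\<close>, so the expected number
  of correct free blocks is at most \<open>m * (1 - isolation_bound / 2)\<close>. A small error forces almost all
  free blocks to be correct, and Markov's inequality bounds the probability of this.\<close>

lemma weak_consistency_bound: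
  fixes \<epsilon> :: real
  assumes "m > 0" and gap: "2 * \<epsilon> * n < real (n div k) - real m"
    and small: "\<epsilon> * n \<le> isolation_bound / 4 * m"
  shows "\<exists>r\<in>shifts m k.
    measure_pmf.prob (outcome r) {\<phi>. err k n (shifted_labeling n k r) \<phi> \<le> \<epsilon>}
      \<le> 1 - isolation_bound / 4"
proof (rule exists_shift_le)
  let ?R = "shifts m k" and ?\<rho> = isolation_bound
  obtain g where g: "\<And>r \<phi>. r \<in> ?R \<Longrightarrow> err k n (shifted_labeling n k r) \<phi> \<le> \<epsilon> \<Longrightarrow>
      real (card {v\<in>{1..n}. shifted_labeling n k r v \<noteq> g \<phi> v}) \<le> \<epsilon> * n"
    using exists_relabeling[OF gap] by blast
  define C where "C b r \<phi> = (of_bool (\<forall>v\<in>block k b. shifted_labeling n k r v = g \<phi> v) :: real)"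
    for b r \<phi>
  let ?f = "\<lambda>r. measure_pmf.prob (outcome r) {\<phi>. err k n (shifted_labeling n k r) \<phi> \<le> \<epsilon>}"
  have block_correct: "(\<Sum>r\<in>?R. measure_pmf.expectation (outcome r) (C b r)) \<le> (\<Sum>r\<in>?R. 1 - ?\<rho> / 2)"
    if b: "b < m" for b
  proof -
    let ?A = "{w. isolated d n w (block k b)}"
    have bn: "b < n div k" using b m_le by simp
    have "(\<Sum>r\<in>?R. measure_pmf.expectation (outcome r) (C b r)) \<le>
        (\<Sum>r\<in>?R. 1 / k * measure_pmf.prob (law r) ?A + measure_pmf.prob (law r) (- ?A))"
    proof (rule averaging[where \<beta> = "\<lambda>_. b"])
      show "(\<Sum>c<k. C b (r(b := c)) \<phi>) \<le> 1" for r \<phi>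
        unfolding C_def by (rule sum_of_bool_agree_le_1[OF bn k_pos])
    qed (use b in \<open>auto simp: C_def\<close>)
    also have "\<dots> \<le> (\<Sum>r\<in>?R. 1 - ?\<rho> / 2)"
    proof (rule sum_mono)
      fix r
      have "1 / k * measure_pmf.prob (law r) ?A \<le> 1 / 2 * measure_pmf.prob (law r) ?A"
        using k_ge_2 by (intro mult_right_mono) (simp_all add: field_simps)
      moreover have "measure_pmf.prob (law r) (- ?A) = 1 - measure_pmf.prob (law r) ?A"
        using measure_pmf.prob_compl[of ?A "law r"] by (simp add: Compl_eq_Diff_UNIV)
      ultimately show "1 / k * measure_pmf.prob (law r) ?A + measure_pmf.prob (law r) (- ?A) \<le> 1 - ?\<rho> / 2"
        using prob_isolated_ge[OF bn, of r] by linarith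
    qed
    finally show ?thesis .
  qed
  have markov: "(m - \<epsilon> * n) * ?f r \<le> (\<Sum>b<m. measure_pmf.expectation (outcome r) (C b r))"
    if r: "r \<in> ?R" for r
  proof -
    have "(m - \<epsilon> * n) * ?f r = measure_pmf.expectation (outcome r)
        (\<lambda>\<phi>. (m - \<epsilon> * n) * of_bool (err k n (shifted_labeling n k r) \<phi> \<le> \<epsilon>))"
      unfolding prob_as_expectation by simp
    also have "\<dots> \<le> measure_pmf.expectation (outcome r) (\<lambda>\<phi>. \<Sum>b<m. C b r \<phi>)"
    proof (intro integral_mono integrable_outcome)
      fix \<phi>
      show "(m - \<epsilon> * n) * of_bool (err k n (shifted_labeling n k r) \<phi> \<le> \<epsilon>) \<le> (\<Sum>b<m. C b r \<phi>)"
      proof (cases "err k n (shifted_labeling n k r) \<phi> \<le> \<epsilon>")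
        case True
        with correct_blocks[OF g[OF r True]] show ?thesis by (simp only: C_def of_bool_eq mult_1_right)
      qed (simp add: C_def sum_nonneg)
    qed
    also have "\<dots> = (\<Sum>b<m. measure_pmf.expectation (outcome r) (C b r))"
      by (intro Bochner_Integration.integral_sum integrable_outcome)
    finally show ?thesis .
  qed
  have \<rho>: "0 < ?\<rho>" "?\<rho> \<le> 1" by (rule isolation_bound_pos isolation_bound_le_1)+
  let ?N = "real (card ?R)"
  have fnn: "0 \<le> (\<Sum>r\<in>?R. ?f r)" by (intro sum_nonneg) simp
  have pos: "0 < m * (1 - ?\<rho> / 4)" using \<rho> assms(1) by simp
  have "m * (1 - ?\<rho> / 4) \<le> m - \<epsilon> * n"
    using small by (simp add: algebra_simps)
  hence "m * (1 - ?\<rho> / 4) * (\<Sum>r\<in>?R. ?f r) \<le> (m - \<epsilon> * n) * (\<Sum>r\<in>?R. ?f r)"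
    using fnn by (rule mult_right_mono)
  also have "\<dots> \<le> (\<Sum>r\<in>?R. \<Sum>b<m. measure_pmf.expectation (outcome r) (C b r))"
    unfolding sum_distrib_left by (intro sum_mono markov)
  also have "\<dots> = (\<Sum>b<m. \<Sum>r\<in>?R. measure_pmf.expectation (outcome r) (C b r))"
    by (rule sum.swap)
  also have "\<dots> \<le> (\<Sum>b<m. \<Sum>r\<in>?R. 1 - ?\<rho> / 2)"
    by (intro sum_mono block_correct) simp
  also have "\<dots> = m * ?N * (1 - ?\<rho> / 2)" by simp
  \<comment> \<open>\<open>1 - x / 2 \<le> (1 - x / 4)\<^sup>2\<close>, and one of the two factors cancels.\<close>
  also have "\<dots> \<le> m * ?N * ((1 - ?\<rho> / 4) * (1 - ?\<rho> / 4))"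
    by (intro mult_left_mono) (simp_all add: algebra_simps)
  also have "\<dots> = m * (1 - ?\<rho> / 4) * (?N * (1 - ?\<rho> / 4))"
    by (simp only: mult_ac)
  finally have "(\<Sum>r\<in>?R. ?f r) \<le> ?N * (1 - ?\<rho> / 4)"
    using pos by (rule mult_left_le_imp_le)
  thus "(\<Sum>r\<in>?R. ?f r) \<le> (\<Sum>r\<in>?R. 1 - ?\<rho> / 4)" by simp
qed

section \<open>Exact recovery and isolated blocks\<close>

text \<open>Exact recovery fails on an isolated block for all but one of its shifts, hence with probability at least
  \<open>1 / 2\<close> as soon as some free block is isolated.\<close>

lemma strong_consistency_bound:
  assumes "m < n div k"
    and noiso: "\<And>r. measure_pmf.prob (law r) {w. \<forall>b<m. \<not> isolated d n w (block k b)} \<le> \<delta>"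
  shows "\<exists>r\<in>shifts m k.
    measure_pmf.prob (outcome r) {\<phi>. err k n (shifted_labeling n k r) \<phi> \<le> 0} \<le> 1 / 2 + \<delta>"
proof (rule exists_shift_le)
  let ?R = "shifts m k"
  let ?A = "{w. \<exists>b<m. isolated d n w (block k b)}"
  define \<beta> where "\<beta> w = (SOME b. b < m \<and> isolated d n w (block k b))" for w
  have gap: "2 * 0 * real n < real (n div k) - real m" using assms(1) by simp
  obtain g where g: "\<And>r \<phi>. r \<in> ?R \<Longrightarrow> err k n (shifted_labeling n k r) \<phi> \<le> 0 \<Longrightarrow>
      real (card {v\<in>{1..n}. shifted_labeling n k r v \<noteq> g \<phi> v}) \<le> 0 * real n"
    using exists_relabeling[OF gap] by blast
  define F where "F r \<phi> = (of_bool (err k n (shifted_labeling n k r) \<phi> \<le> 0) :: real)" for r \<phi>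
  have agree: "shifted_labeling n k r v = g \<phi> v"
    if "r \<in> ?R" "err k n (shifted_labeling n k r) \<phi> \<le> 0" "v \<in> {1..n}" for r \<phi> v
  proof -
    have "{v\<in>{1..n}. shifted_labeling n k r v \<noteq> g \<phi> v} = {}"
      using g[OF that(1,2)] by simp
    hence "v \<notin> {v\<in>{1..n}. shifted_labeling n k r v \<noteq> g \<phi> v}" by (simp only: empty_iff not_False_eq_True)
    thus ?thesis using that(3) by simp
  qed
  have \<beta>: "\<beta> w < m \<and> isolated d n w (block k (\<beta> w))" if "w \<in> ?A" for w
    unfolding \<beta>_def
    by (rule someI_ex[of "\<lambda>b. b < m \<and> isolated d n w (block k b)"]) (use that in simp)
  have "(\<Sum>r\<in>?R. measure_pmf.expectation (outcome r) (F r)) \<le>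
      (\<Sum>r\<in>?R. 1 / k * measure_pmf.prob (law r) ?A + measure_pmf.prob (law r) (- ?A))"
  proof (rule averaging[where \<beta> = \<beta>])
    fix w r \<phi> assume w: "w \<in> ?A" and r: "r \<in> ?R"
    have b: "\<beta> w < m" "\<beta> w < n div k" using \<beta>[OF w] m_le by auto
    have "(\<Sum>c<k. F (r(\<beta> w := c)) \<phi>) = (\<Sum>c<k. of_bool (c < k \<and>
        err k n (shifted_labeling n k (r(\<beta> w := c))) \<phi> \<le> 0))"
      by (intro sum.cong) (simp_all add: F_def)
    also have "\<dots> \<le> 1"
    proof (rule sum_of_bool_agree_le_1[OF b(2) k_pos], intro ballI)
      fix c v assume "c < k \<and> err k n (shifted_labeling n k (r(\<beta> w := c))) \<phi> \<le> 0"
        and v: "v \<in> block k (\<beta> w)"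
      thus "shifted_labeling n k (r(\<beta> w := c)) v = g \<phi> v"
        using block_in_nodes[OF b(1)] shifts_upd[OF r b(1)] by (intro agree) auto
    qed
    finally show "(\<Sum>c<k. F (r(\<beta> w := c)) \<phi>) \<le> 1" .
  qed (use \<beta> in \<open>auto simp: F_def\<close>)
  also have "\<dots> \<le> (\<Sum>r\<in>?R. 1 / 2 + \<delta>)"
  proof (rule sum_mono)
    fix r
    have "1 / k * measure_pmf.prob (law r) ?A \<le> 1 / 2 * 1"
      using k_ge_2 by (intro mult_mono) (simp_all add: field_simps)
    moreover have "- ?A = {w. \<forall>b<m. \<not> isolated d n w (block k b)}" by auto
    hence "measure_pmf.prob (law r) (- ?A) \<le> \<delta>" using noiso[of r] by simp
    ultimately show "1 / k * measure_pmf.prob (law r) ?A + measure_pmf.prob (law r) (- ?A) \<le> 1 / 2 + \<delta>"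
      by linarith
  qed
  finally show "(\<Sum>r\<in>?R. measure_pmf.prob (outcome r) {\<phi>. err k n (shifted_labeling n k r) \<phi> \<le> 0})
      \<le> (\<Sum>r\<in>?R. 1 / 2 + \<delta>)"
    unfolding F_def prob_as_expectation .
qed

definition pair_bound :: real where
  "pair_bound = exp (- 2 * p * a * real (k\<^sup>2 * ((n - 2) choose (d - 2))))"

text \<open>The events that two blocks are isolated are correlated only through the edges that meet both.\<close>

lemma prob_two_isolated_le:
  assumes "b < n div k" "b' < n div k" "b \<noteq> b'"
  shows "measure_pmf.prob (law r) {w. isolated d n w (block k b) \<and> isolated d n w (block k b')} \<le>
    measure_pmf.prob (law r) {w. isolated d n w (block k b)} *
    measure_pmf.prob (law r) {w. isolated d n w (block k b')} / pair_bound"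
proof -
  let ?T = "touching d n (block k b)" and ?T' = "touching d n (block k b')"
  have "{w. isolated d n w (block k b) \<and> isolated d n w (block k b')} = {w. \<forall>e\<in>?T \<union> ?T'. \<not> w e}"
    by (auto simp: isolated_iff_no_touching_edge)
  hence "measure_pmf.prob (law r) {w. isolated d n w (block k b) \<and> isolated d n w (block k b')} =
      no_edge_prob r (?T \<union> ?T')" (is "?P = _")
    using prob_law_no_edge[of "?T \<union> ?T'" r] touching_subset by simp
  hence prod: "?P * no_edge_prob r (?T \<inter> ?T') = no_edge_prob r ?T * no_edge_prob r ?T'"
    unfolding no_edge_prob_def by (simp only: prod.union_inter[OF finite_touching finite_touching])
  have "real (card (?T \<inter> ?T')) \<le> real (k\<^sup>2 * ((n - 2) choose (d - 2)))"
    using card_touching_two_blocks[OF assms] by (simp only: of_nat_le_iff)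
  hence "pair_bound \<le> no_edge_prob r (?T \<inter> ?T')"
    unfolding pair_bound_def no_edge_prob_def
    by (intro no_edge_factors_ge_exp q_nonneg q_le_p a_nonneg pa_le) auto
  hence "?P * pair_bound \<le> no_edge_prob r ?T * no_edge_prob r ?T'"
    unfolding prod[symmetric] by (intro mult_left_mono) simp_all
  thus ?thesis
    unfolding prob_isolated_eq by (simp add: pos_le_divide_eq pair_bound_def)
qed

lemma integrable_law: "integrable (measure_pmf (law r)) (f :: _ \<Rightarrow> real)"
  by (rule integrable_measure_pmf_finite[OF finite_subset[OF set_law finite_weights]])

text \<open>The second moment method for the number of isolated free blocks. Its mean is at least
  \<open>m * isolation_bound\<close>, and its relative variance is at most the reciprocal of the mean plus a
  correlation term, which is small because few edges meet two given blocks.\<close>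

lemma prob_no_isolated_block:
  assumes "m > 0"
  shows "measure_pmf.prob (law r) {w. \<forall>b<m. \<not> isolated d n w (block k b)}
    \<le> 1 / (m * isolation_bound) + (1 / pair_bound - 1)"
proof -
  let ?E = "measure_pmf.expectation (law r)"
  let ?P = "measure_pmf.prob (law r)"
  define I where "I b w = (of_bool (isolated d n w (block k b)) :: real)" for b w
  define x where "x b = ?E (I b)" for b
  define \<mu> where "\<mu> = (\<Sum>b<m. x b)"
  have z: "0 < pair_bound" by (simp add: pair_bound_def)
  have x: "x b = ?P {w. isolated d n w (block k b)}" for b
    unfolding x_def I_def prob_as_expectation ..
  have "(\<Sum>b<m. isolation_bound) \<le> \<mu>"
    unfolding \<mu>_def x using m_le by (intro sum_mono prob_isolated_ge) auto
  hence \<mu>: "m * isolation_bound \<le> \<mu>" by simp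
  have pos: "0 < m * isolation_bound" using assms isolation_bound_pos by simp
  have \<mu>_pos: "0 < \<mu>" using \<mu> pos by linarith
  have pair: "?E (\<lambda>w. I b w * I b' w) \<le> of_bool (b = b') * x b + x b * x b' / pair_bound"
    if "b < m" "b' < m" for b b'
  proof (cases "b = b'")
    case True
    have "?E (\<lambda>w. I b w * I b' w) = x b"
      unfolding True x_def by (intro arg_cong[of _ _ ?E]) (auto simp: I_def fun_eq_iff)
    with True z show ?thesis by (simp add: x)
  next
    case False
    have "?E (\<lambda>w. I b w * I b' w) =
        ?P {w. isolated d n w (block k b) \<and> isolated d n w (block k b')}"
      unfolding prob_as_expectation by (intro arg_cong[of _ _ ?E]) (auto simp: I_def fun_eq_iff)
    also have "\<dots> \<le> x b * x b' / pair_bound"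
      unfolding x using that m_le False by (intro prob_two_isolated_le) auto
    finally show ?thesis using False by simp
  qed
  have mean: "?E (\<lambda>w. \<Sum>b<m. I b w) = \<mu>"
    unfolding \<mu>_def x_def by (intro Bochner_Integration.integral_sum integrable_law)
  have "?E (\<lambda>w. (\<Sum>b<m. I b w)\<^sup>2) = (\<Sum>b<m. \<Sum>b'<m. ?E (\<lambda>w. I b w * I b' w))"
    unfolding power2_eq_square sum_product
    by (simp add: Bochner_Integration.integral_sum integrable_law)
  also have "\<dots> \<le> (\<Sum>b<m. \<Sum>b'<m. of_bool (b = b') * x b + x b * x b' / pair_bound)"
    by (intro sum_mono pair) auto
  also have "\<dots> = (\<Sum>b<m. \<Sum>b'<m. of_bool (b = b') * x b) + \<mu>\<^sup>2 / pair_bound"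
    unfolding \<mu>_def power2_eq_square sum_product by (simp add: sum.distrib sum_divide_distrib)
  also have "(\<Sum>b<m. \<Sum>b'<m. of_bool (b = b') * x b) = \<mu>"
    unfolding \<mu>_def by (simp add: of_bool_def if_distrib[of "\<lambda>t. t * _"] cong: if_cong)
  finally have second: "?E (\<lambda>w. (\<Sum>b<m. I b w)\<^sup>2) \<le> \<mu> + \<mu>\<^sup>2 / pair_bound" .
  \<comment> \<open>Without an isolated block, the number of isolated blocks deviates by \<open>\<mu>\<close> from its mean.\<close>
  have "\<mu>\<^sup>2 * ?P {w. \<forall>b<m. \<not> isolated d n w (block k b)} =
      ?E (\<lambda>w. \<mu>\<^sup>2 * of_bool (\<forall>b<m. \<not> isolated d n w (block k b)))"
    unfolding prob_as_expectation by simp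
  also have "\<dots> \<le> ?E (\<lambda>w. ((\<Sum>b<m. I b w) - \<mu>)\<^sup>2)"
  proof (intro integral_mono integrable_law)
    fix w
    show "\<mu>\<^sup>2 * of_bool (\<forall>b<m. \<not> isolated d n w (block k b)) \<le> ((\<Sum>b<m. I b w) - \<mu>)\<^sup>2"
    proof (cases "\<forall>b<m. \<not> isolated d n w (block k b)")
      case True
      hence "(\<Sum>b<m. I b w) = 0" by (intro sum.neutral) (simp add: I_def)
      with True show ?thesis by simp
    next
      case False
      show ?thesis unfolding of_bool_eq_0_iff[THEN iffD2, OF False] by simp
    qed
  qed
  also have "\<dots> = ?E (\<lambda>w. (\<Sum>b<m. I b w)\<^sup>2 - 2 * \<mu> * (\<Sum>b<m. I b w) + \<mu>\<^sup>2)"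
    by (intro arg_cong[of _ _ ?E]) (simp add: fun_eq_iff power2_diff algebra_simps)
  also have "\<dots> = ?E (\<lambda>w. (\<Sum>b<m. I b w)\<^sup>2) - 2 * \<mu> * \<mu> + \<mu>\<^sup>2"
    by (simp add: Bochner_Integration.integral_add Bochner_Integration.integral_diff
          integrable_law mean del: Bochner_Integration.integral_sum)
  also have "\<dots> \<le> \<mu> + \<mu>\<^sup>2 / pair_bound - \<mu>\<^sup>2"
    using second by (simp add: power2_eq_square)
  also have "\<dots> = \<mu>\<^sup>2 * (1 / \<mu> + (1 / pair_bound - 1))"
    using \<mu>_pos by (simp add: field_simps power2_eq_square)
  finally have "?P {w. \<forall>b<m. \<not> isolated d n w (block k b)} \<le> 1 / \<mu> + (1 / pair_bound - 1)"
    using \<mu>_pos by (simp add: mult_le_cancel_left_pos)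
  also have "1 / \<mu> \<le> 1 / (m * isolation_bound)"
    using \<mu> pos by (intro divide_left_mono) auto
  finally show ?thesis by simp
qed

section \<open>Second moment of the overlap\<close>

text \<open>An unnormalized form of the difference in the definition of detection, restricted to complete blocks.
  There the groups have equal size, so the average over the shifts vanishes for every fixed estimate.\<close>

definition overlap_gap :: "nat \<Rightarrow> nat \<Rightarrow> nat \<Rightarrow> (nat \<Rightarrow> nat) \<Rightarrow> (nat \<Rightarrow> nat) \<Rightarrow> real" where
  "overlap_gap i j l \<Psi> \<phi> = (\<Sum>v\<in>{1..k * (n div k)}.
     (of_bool (\<Psi> v = i) - of_bool (\<Psi> v = j)) * of_bool (\<phi> v = l))"

text \<open>Each group has between \<open>n div k\<close> and \<open>n div k + 1\<close> nodes, and at most one of them lies outside the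
  complete blocks. This costs 2 in the count, which \<open>4 \<le> \<epsilon> * (n div k)\<close> allows to absorb.\<close>

lemma detects_imp_overlap_gap:
  fixes \<epsilon> :: real
  assumes "n div k > 0" "4 \<le> \<epsilon> * (n div k)" "\<epsilon> > 0"
    and "detects k n \<epsilon> (shifted_labeling n k r) \<phi>"
  shows "\<exists>i\<in>{1..k}. \<exists>j\<in>{1..k}. \<exists>l\<in>{1..k}.
    (\<epsilon> * (n div k) / 2)\<^sup>2 \<le> (overlap_gap i j l (shifted_labeling n k r) \<phi>)\<^sup>2"
proof -
  let ?\<psi> = "shifted_labeling n k r"
  define B where "B = n div k"
  obtain i j l where ijl: "i \<in> {1..k}" "j \<in> {1..k}" "l \<in> {1..k}"
    and gap: "\<epsilon> \<le> real (card (group_of n ?\<psi> i \<inter> group_of n \<phi> l)) / real (card (group_of n ?\<psi> i))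
        - real (card (group_of n ?\<psi> j \<inter> group_of n \<phi> l)) / real (card (group_of n ?\<psi> j))"
    using assms(4) unfolding detects_def Let_def by blast
  define N where "N i = card ({v\<in>{1..k * B}. ?\<psi> v = i} \<inter> group_of n \<phi> l)" for i
  have B: "B > 0" using assms(1) by (simp add: B_def)
  have kB: "k * B \<le> n" by (simp add: B_def)
  have N_le: "N i \<le> B" if "i \<in> {1..k}" for i
  proof -
    have "N i \<le> card {v\<in>{1..k * B}. ?\<psi> v = i}"
      unfolding N_def by (intro card_mono) auto
    also have "\<dots> = B"
      using card_label_in_blocks[OF k_pos that, of 0 B n r] by (simp add: B_def)
    finally show ?thesis .
  qed
  have size: "B \<le> card (group_of n ?\<psi> i)" "card (group_of n ?\<psi> i) \<le> Suc B" if "i \<in> {1..k}" for i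
    using card_group_of_shifted_labeling[OF k_pos that] by (simp_all add: B_def)
  have "real (card (group_of n ?\<psi> i \<inter> group_of n \<phi> l)) / real (card (group_of n ?\<psi> i)) \<le> (real (N i) + 1) / real B"
  proof (intro frac_le)
    have "card (group_of n ?\<psi> i \<inter> group_of n \<phi> l) \<le> Suc (N i)"
      using group_of_shifted_labeling_split[OF k_pos ijl(1)] by (simp add: N_def B_def)
    thus "real (card (group_of n ?\<psi> i \<inter> group_of n \<phi> l)) \<le> real (N i) + 1" by simp
  qed (use B size[OF ijl(1)] in auto)
  moreover have "real (N j) / (real B + 1) \<le>
      real (card (group_of n ?\<psi> j \<inter> group_of n \<phi> l)) / real (card (group_of n ?\<psi> j))"
  proof (intro frac_le)
    have "N j \<le> card (group_of n ?\<psi> j \<inter> group_of n \<phi> l)"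
      unfolding N_def using kB by (intro card_mono) (auto simp: group_of_def)
    thus "real (N j) \<le> real (card (group_of n ?\<psi> j \<inter> group_of n \<phi> l))" by simp
  qed (use B size[OF ijl(2)] in auto)
  moreover have "(real (N j) - 1) / real B \<le> real (N j) / (real B + 1)"
  proof -
    have "(real (N j) - 1) * (real B + 1) \<le> real (N j) * B"
      using N_le[OF ijl(2)] by (simp add: algebra_simps)
    thus ?thesis using B by (simp add: field_simps)
  qed
  ultimately have "\<epsilon> \<le> (real (N i) + 1) / real B - (real (N j) - 1) / real B"
    using gap by linarith
  also have "\<dots> = (real (N i) - real (N j) + 2) / B"
    by (simp add: diff_divide_distrib[symmetric])
  finally have "\<epsilon> * B \<le> real (N i) - real (N j) + 2"
    using B by (simp add: pos_le_divide_eq)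
  hence "\<epsilon> * B / 2 \<le> real (N i) - real (N j)"
    using assms(2) by (simp add: B_def)
  moreover have "real (N i') = (\<Sum>v\<in>{1..k * B}. of_bool (?\<psi> v = i') * of_bool (\<phi> v = l))" for i'
  proof -
    have "{v\<in>{1..k * B}. ?\<psi> v = i'} \<inter> group_of n \<phi> l = {1..k * B} \<inter> {v. ?\<psi> v = i' \<and> \<phi> v = l}"
      using kB by (auto simp: group_of_def)
    thus ?thesis
      unfolding N_def of_bool_conj[symmetric] by (simp add: of_bool_def sum.If_cases)
  qed
  hence "overlap_gap i j l ?\<psi> \<phi> = real (N i) - real (N j)"
    unfolding overlap_gap_def B_def[symmetric] by (simp add: left_diff_distrib sum_subtractf)
  ultimately have "\<epsilon> * B / 2 \<le> overlap_gap i j l ?\<psi> \<phi>" by simp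
  hence "(\<epsilon> * B / 2)\<^sup>2 \<le> (overlap_gap i j l ?\<psi> \<phi>)\<^sup>2"
    using assms(3) by (intro power_mono) auto
  thus ?thesis using ijl unfolding B_def by blast
qed

text \<open>The square expands into pairs of nodes. For a pair in different blocks the term averages to 0 if the
  block of the first node is isolated, because shifting this block leaves the sign of the second
  node alone. The pairs within a block are few.\<close>

lemma overlap_gap_second_moment:
  assumes m: "m = n div k" and ij: "i \<in> {1..k}" "j \<in> {1..k}"
  shows "(\<Sum>r\<in>shifts m k. measure_pmf.expectation (outcome r)
      (\<lambda>\<phi>. (overlap_gap i j l (shifted_labeling n k r) \<phi>)\<^sup>2)) \<le>
    (\<Sum>r\<in>shifts m k. real (k\<^sup>2 * m) + real (k\<^sup>2 * m\<^sup>2) * (1 - isolation_bound))"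
proof -
  let ?R = "shifts m k" and ?V = "{1..k * m}" and ?\<delta> = "1 - isolation_bound"
  let ?\<psi> = "shifted_labeling n k"
  define s where "s r v = (of_bool (?\<psi> r v = i) - of_bool (?\<psi> r v = j) :: real)" for r v
  define h where "h \<phi> v = (of_bool (\<phi> v = l) :: real)" for \<phi> :: "nat \<Rightarrow> nat" and v
  define F where "F u v r \<phi> = (s r u * h \<phi> u) * (s r v * h \<phi> v)" for u v r \<phi>
  have sh: "\<bar>s r v * h \<phi> v\<bar> \<le> 1" for r v \<phi>
    by (auto simp: s_def h_def)
  have F_le: "F u v r \<phi> \<le> 1" for u v r \<phi>
  proof -
    have "\<bar>F u v r \<phi>\<bar> \<le> 1 * 1"
      unfolding F_def abs_mult[of "s r u * h \<phi> u"] by (intro mult_mono sh) auto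
    thus ?thesis by simp
  qed
  have \<delta>: "0 \<le> ?\<delta>" using isolation_bound_le_1 by simp
  have pair: "(\<Sum>r\<in>?R. measure_pmf.expectation (outcome r) (F u v r)) \<le>
      (\<Sum>r\<in>?R. of_bool ((v - 1) div k = (u - 1) div k) + ?\<delta>)" if uv: "u \<in> ?V" "v \<in> ?V" for u v
  proof (cases "(v - 1) div k = (u - 1) div k")
    case True
    have "measure_pmf.expectation (outcome r) (F u v r) \<le> measure_pmf.expectation (outcome r) (\<lambda>_. 1)" for r
      by (intro integral_mono integrable_outcome F_le)
    hence "measure_pmf.expectation (outcome r) (F u v r) \<le> 1" for r by simp
    moreover have "1 \<le> (of_bool ((v - 1) div k = (u - 1) div k) :: real) + ?\<delta>"
      using True \<delta> by simp
    ultimately show ?thesis by (intro sum_mono) (rule order.trans)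
  next
    case False
    define b where "b = (u - 1) div k"
    let ?A = "{w. isolated d n w (block k b)}"
    have u: "u \<in> block k b" using uv(1) by (simp add: block_iff[OF k_pos] b_def)
    have v: "v \<notin> block k b" using False by (simp add: block_iff[OF k_pos] b_def)
    have b: "b < m" using uv(1) div_less_iff_le_mult[OF k_pos, of u m] by (simp add: b_def)
    have bn: "b < n div k" using b m by simp
    have "(\<Sum>r\<in>?R. measure_pmf.expectation (outcome r) (F u v r)) \<le>
        (\<Sum>r\<in>?R. 0 / k * measure_pmf.prob (law r) ?A + measure_pmf.prob (law r) (- ?A))"
    proof (rule averaging[where \<beta> = "\<lambda>_. b"])
      fix r \<phi>
      have "(\<Sum>c<k. F u v (r(b := c)) \<phi>) =
          (\<Sum>c<k. s (r(b := c)) u) * (h \<phi> u * (s r v * h \<phi> v))"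
        unfolding F_def sum_distrib_right
        by (simp add: s_def shifted_labeling_upd_other[OF v k_pos] mult.assoc)
      also have "(\<Sum>c<k. s (r(b := c)) u) = 0"
        unfolding s_def sum_subtractf
        by (simp only: sum_of_bool_label[OF bn u k_pos] ij diff_self)
      finally show "(\<Sum>c<k. F u v (r(b := c)) \<phi>) \<le> 0"
        by (simp only: mult_zero_left order_refl)
    qed (use b F_le in auto)
    also have "\<dots> \<le> (\<Sum>r\<in>?R. ?\<delta>)"
    proof (rule sum_mono)
      fix r
      have "measure_pmf.prob (law r) (- ?A) = 1 - measure_pmf.prob (law r) ?A"
        using measure_pmf.prob_compl[of ?A "law r"] by (simp add: Compl_eq_Diff_UNIV)
      thus "0 / k * measure_pmf.prob (law r) ?A + measure_pmf.prob (law r) (- ?A) \<le> ?\<delta>"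
        using prob_isolated_ge[OF bn, of r] by simp
    qed
    finally show ?thesis using False by simp
  qed
  have row: "(\<Sum>v\<in>?V. of_bool ((v - 1) div k = b) :: real) \<le> k" for b
  proof -
    have "?V \<inter> {v. (v - 1) div k = b} \<subseteq> block k b"
      by (auto simp: block_iff[OF k_pos])
    from card_mono[OF finite_block this] have "card (?V \<inter> {v. (v - 1) div k = b}) \<le> k"
      unfolding card_block .
    thus ?thesis by (simp add: of_bool_def sum.If_cases)
  qed
  have "(\<Sum>r\<in>?R. measure_pmf.expectation (outcome r) (\<lambda>\<phi>. (overlap_gap i j l (?\<psi> r) \<phi>)\<^sup>2)) =
      (\<Sum>r\<in>?R. \<Sum>u\<in>?V. \<Sum>v\<in>?V. measure_pmf.expectation (outcome r) (F u v r))"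
    unfolding overlap_gap_def power2_eq_square sum_product m[symmetric] F_def s_def h_def
    by (simp add: Bochner_Integration.integral_sum integrable_outcome)
  also have "\<dots> = (\<Sum>u\<in>?V. \<Sum>v\<in>?V. \<Sum>r\<in>?R. measure_pmf.expectation (outcome r) (F u v r))"
    by (subst sum.swap, rule sum.cong[OF refl], rule sum.swap)
  also have "\<dots> \<le> (\<Sum>u\<in>?V. \<Sum>v\<in>?V. \<Sum>r\<in>?R. of_bool ((v - 1) div k = (u - 1) div k) + ?\<delta>)"
    by (intro sum_mono pair)
  also have "\<dots> = (\<Sum>r\<in>?R. \<Sum>u\<in>?V. \<Sum>v\<in>?V. of_bool ((v - 1) div k = (u - 1) div k) + ?\<delta>)"
    by (subst (2) sum.swap, subst sum.swap, rule refl)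
  also have "\<dots> \<le> (\<Sum>r\<in>?R. real (k\<^sup>2 * m) + real (k\<^sup>2 * m\<^sup>2) * ?\<delta>)"
  proof (rule sum_mono)
    have "(\<Sum>u\<in>?V. \<Sum>v\<in>?V. of_bool ((v - 1) div k = (u - 1) div k) + ?\<delta>) =
        (\<Sum>u\<in>?V. \<Sum>v\<in>?V. of_bool ((v - 1) div k = (u - 1) div k)) + (k * m) * ((k * m) * ?\<delta>)"
      by (simp add: sum.distrib)
    also have "\<dots> \<le> (\<Sum>u\<in>?V. real k) + (k * m) * ((k * m) * ?\<delta>)"
      by (intro add_right_mono sum_mono row)
    also have "\<dots> = real (k\<^sup>2 * m) + real (k\<^sup>2 * m\<^sup>2) * ?\<delta>"
      by (simp add: power2_eq_square)
    finally show "(\<Sum>u\<in>?V. \<Sum>v\<in>?V. of_bool ((v - 1) div k = (u - 1) div k) + ?\<delta>) \<le>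
        real (k\<^sup>2 * m) + real (k\<^sup>2 * m\<^sup>2) * ?\<delta>" .
  qed
  finally show ?thesis .
qed

text \<open>Markov's inequality for the squared gap, summed over the \<open>k ^ 3\<close> choices of the labels.\<close>

lemma detection_bound:
  fixes \<epsilon> :: real
  assumes m: "m = n div k" "m > 0" and \<epsilon>: "4 \<le> \<epsilon> * m" "\<epsilon> > 0"
  shows "\<exists>r\<in>shifts m k.
    measure_pmf.prob (outcome r) {\<phi>. detects k n \<epsilon> (shifted_labeling n k r) \<phi>}
      \<le> 4 * real k ^ 5 * (1 / m + (1 - isolation_bound)) / \<epsilon>\<^sup>2"
proof (rule exists_shift_le)
  let ?R = "shifts m k" and ?\<delta> = "1 - isolation_bound" and ?I = "{1..k}"
  let ?c = "(\<epsilon> * m / 2)\<^sup>2"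
  let ?G = "\<lambda>i j l r \<phi>. (overlap_gap i j l (shifted_labeling n k r) \<phi>)\<^sup>2"
  let ?S = "real (k\<^sup>2 * m) + real (k\<^sup>2 * m\<^sup>2) * ?\<delta>"
  have c: "0 < ?c" using m \<epsilon> by simp
  have pointwise: "?c * measure_pmf.prob (outcome r) {\<phi>. detects k n \<epsilon> (shifted_labeling n k r) \<phi>}
      \<le> (\<Sum>i\<in>?I. \<Sum>j\<in>?I. \<Sum>l\<in>?I. measure_pmf.expectation (outcome r) (?G i j l r))" for r
  proof -
    have "?c * measure_pmf.prob (outcome r) {\<phi>. detects k n \<epsilon> (shifted_labeling n k r) \<phi>} =
        measure_pmf.expectation (outcome r)
          (\<lambda>\<phi>. ?c * of_bool (detects k n \<epsilon> (shifted_labeling n k r) \<phi>))"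
      unfolding prob_as_expectation by simp
    also have "\<dots> \<le> measure_pmf.expectation (outcome r) (\<lambda>\<phi>. \<Sum>i\<in>?I. \<Sum>j\<in>?I. \<Sum>l\<in>?I. ?G i j l r \<phi>)"
    proof (intro integral_mono integrable_outcome)
      fix \<phi>
      show "?c * of_bool (detects k n \<epsilon> (shifted_labeling n k r) \<phi>) \<le> (\<Sum>i\<in>?I. \<Sum>j\<in>?I. \<Sum>l\<in>?I. ?G i j l r \<phi>)"
      proof (cases "detects k n \<epsilon> (shifted_labeling n k r) \<phi>")
        case True
        obtain i j l where ijl: "i \<in> ?I" "j \<in> ?I" "l \<in> ?I" "?c \<le> ?G i j l r \<phi>"
          using detects_imp_overlap_gap[folded m(1), OF m(2) \<epsilon> True] by blast
        have "?G i j l r \<phi> \<le> (\<Sum>l\<in>?I. ?G i j l r \<phi>)"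
          using ijl by (intro member_le_sum) auto
        also have "\<dots> \<le> (\<Sum>j\<in>?I. \<Sum>l\<in>?I. ?G i j l r \<phi>)"
          using ijl by (intro member_le_sum[where f = "\<lambda>j. \<Sum>l\<in>?I. ?G i j l r \<phi>"] sum_nonneg) auto
        also have "\<dots> \<le> (\<Sum>i\<in>?I. \<Sum>j\<in>?I. \<Sum>l\<in>?I. ?G i j l r \<phi>)"
          using ijl by (intro member_le_sum[where f = "\<lambda>i. \<Sum>j\<in>?I. \<Sum>l\<in>?I. ?G i j l r \<phi>"] sum_nonneg) auto
        finally show ?thesis using True ijl(4) by simp
      next
        case False
        show ?thesis unfolding of_bool_eq_0_iff[THEN iffD2, OF False]
          by (simp add: sum_nonneg)
      qed
    qed
    also have "\<dots> = (\<Sum>i\<in>?I. \<Sum>j\<in>?I. \<Sum>l\<in>?I. measure_pmf.expectation (outcome r) (?G i j l r))"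
      by (simp add: Bochner_Integration.integral_sum integrable_outcome)
    finally show ?thesis .
  qed
  let ?D = "\<lambda>r. measure_pmf.prob (outcome r) {\<phi>. detects k n \<epsilon> (shifted_labeling n k r) \<phi>}"
  have "?c * (\<Sum>r\<in>?R. ?D r) \<le>
      (\<Sum>r\<in>?R. \<Sum>i\<in>?I. \<Sum>j\<in>?I. \<Sum>l\<in>?I. measure_pmf.expectation (outcome r) (?G i j l r))"
    unfolding sum_distrib_left by (intro sum_mono pointwise)
  also have "\<dots> = (\<Sum>i\<in>?I. \<Sum>j\<in>?I. \<Sum>l\<in>?I. \<Sum>r\<in>?R. measure_pmf.expectation (outcome r) (?G i j l r))"
    by (simp only: sum.swap[of _ _ ?R])
  also have "\<dots> \<le> (\<Sum>i\<in>?I. \<Sum>j\<in>?I. \<Sum>l\<in>?I. \<Sum>r\<in>?R. ?S)"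
    by (intro sum_mono overlap_gap_second_moment m(1))
  also have "\<dots> = card ?R * (real k ^ 3 * ?S)"
    by (simp add: power3_eq_cube)
  also have "real k ^ 3 * ?S = ?c * (4 * real k ^ 5 * (1 / m + ?\<delta>) / \<epsilon>\<^sup>2)"
    using m(2) \<epsilon>(2) by (simp add: field_simps power2_eq_square eval_nat_numeral)
  finally have "?c * (\<Sum>r\<in>?R. ?D r) \<le> ?c * (card ?R * (4 * real k ^ 5 * (1 / m + ?\<delta>) / \<epsilon>\<^sup>2))"
    by (simp only: mult_ac)
  hence "(\<Sum>r\<in>?R. ?D r) \<le> card ?R * (4 * real k ^ 5 * (1 / m + ?\<delta>) / \<epsilon>\<^sup>2)"
    using c by (rule mult_left_le_imp_le)
  thus "(\<Sum>r\<in>?R. ?D r) \<le> (\<Sum>r\<in>?R. 4 * real k ^ 5 * (1 / m + ?\<delta>) / \<epsilon>\<^sup>2)" by simp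
qed

end

section \<open>Asymptotics\<close>

lemma filterlim_div_at_top:
  assumes "k > 0"
  shows "filterlim (\<lambda>n::nat. n div k) at_top at_top"
  unfolding filterlim_at_top
proof
  fix Z
  show "\<forall>\<^sub>F n in at_top. Z \<le> n div k"
    using eventually_ge_at_top[of "k * Z"]
  proof eventually_elim
    case (elim n)
    from div_le_mono[OF elim, of k] assms show ?case by simp
  qed
qed

text \<open>For weak and strong consistency half of the blocks are free, and the other half are anchors.\<close>

lemma half_blocks_bounds:
  fixes n k :: nat
  assumes "k > 0" "2 * k \<le> n"
  defines "B \<equiv> n div k" and "m \<equiv> n div k div 2"
  shows "0 < m" "m < B" "real n / (4 * k) \<le> real B - real m" "real n / (8 * k) \<le> real m"
proof -
  have B2: "2 \<le> B" using div_le_mono[OF assms(2), of k] assms(1) by (simp add: B_def)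
  have "n < k * B + k"
    using dividend_less_times_div[OF assms(1), of n] by (simp add: B_def add.commute)
  also have "k * B + k \<le> k * (2 * B)"
    using B2 by (simp add: algebra_simps)
  finally have "real n \<le> real k * (2 * real B)"
    unfolding of_nat_mult[symmetric] of_nat_numeral[symmetric, where 'a = real]
    by (simp only: of_nat_le_iff of_nat_mult[symmetric] less_imp_le)
  hence nB: "real n / k \<le> 2 * real B"
    using assms(1) by (simp add: field_simps)
  have m: "2 * m \<le> B" "B \<le> 2 * m + 1" by (auto simp: m_def B_def)
  show "0 < m" "m < B" using m B2 by auto
  define X where "X = real n / k"
  have X: "real n / (4 * k) = X / 4" "real n / (8 * k) = X / 8"
    by (simp_all add: X_def)
  have "real (2 * m) \<le> real B" "real B \<le> real (4 * m)"
    unfolding of_nat_le_iff using m B2 by simp_all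
  hence "real B \<le> 2 * (real B - real m)" "real B \<le> 4 * real m" by simp_all
  with nB have "X / 4 \<le> real B - real m" "X / 8 \<le> real m" by (simp_all add: X_def[symmetric])
  thus "real n / (4 * k) \<le> real B - real m" "real n / (8 * k) \<le> real m" by (simp_all only: X)
qed

text \<open>The shift may be chosen anew for every \<open>n\<close>, so bounds for single values of \<open>n\<close> combine into one
  sequence of hidden partitions.\<close>

lemma choose_admissible_seq:
  assumes "k > 0" "C > 1"
    and ex: "\<forall>\<^sub>F n in sequentially. \<exists>r. P n (shifted_labeling n k r)"
  obtains \<Psi> where "admissible_seq C k \<Psi>" "\<forall>\<^sub>F n in sequentially. P n (\<Psi> n)"
proof
  define \<Psi> where "\<Psi> n = shifted_labeling n k (SOME r. P n (shifted_labeling n k r))" for n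
  show "\<forall>\<^sub>F n in sequentially. P n (\<Psi> n)"
    using ex
  proof eventually_elim
    case (elim n)
    then show ?case unfolding \<Psi>_def by (rule someI_ex)
  qed
  have "filterlim (\<lambda>n. real (n div k)) at_top sequentially"
    by (rule filterlim_compose[OF filterlim_real_sequentially filterlim_div_at_top[OF assms(1)]])
  hence "\<forall>\<^sub>F n in sequentially. 1 / (C - 1) \<le> real (n div k)"
    by (simp add: filterlim_at_top)
  thus "admissible_seq C k \<Psi>"
    unfolding admissible_seq_def
  proof eventually_elim
    case (elim n)
    hence "real (Suc (n div k)) \<le> C * real (n div k)"
      using assms(2) by (simp add: field_simps)
    thus ?case
      unfolding \<Psi>_def using assms by (intro admissible_shifted_labeling) auto
  qed
qed

lemma tendsto_not_eventually_le:
  fixes f :: "nat \<Rightarrow> real"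
  assumes "f \<longlonglongrightarrow> l" "\<forall>\<^sub>F n in sequentially. f n \<le> c" "c < l"
  shows False
proof -
  have "l \<le> c"
    using tendsto_upperbound[OF assms(1,2)] by simp
  with assms(3) show False by simp
qed

lemma finite_labelings: "finite (labelings n k)"
  unfolding labelings_def by (intro finite_PiE) auto

lemma shifted_model_estimator:
  assumes "is_estimator k \<Phi>" "k \<ge> 2" "0 \<le> q" "q \<le> p" "0 \<le> a" "p * a \<le> 1 / 2" "m \<le> n div k"
  shows "shifted_model k n m p q a (\<Phi> n)"
proof
  show "finite (set_pmf (\<Phi> n w))" for w
    using assms(1) finite_subset[OF _ finite_labelings[of n k]] by (simp add: is_estimator_def)
qed (use assms in auto)

lemma detects_mono: "detects k n \<epsilon>' \<Psi> \<phi> \<Longrightarrow> \<epsilon> \<le> \<epsilon>' \<Longrightarrow> detects k n \<epsilon> \<Psi> \<phi>"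
  unfolding detects_def Let_def by (meson order.trans)

text \<open>The growth condition of strong consistency is the weakest of the three and thus common to all of them.\<close>

locale sparse_regime =
  fixes d k :: nat and p q C :: real and \<alpha> :: "nat \<Rightarrow> real"
  assumes d: "d \<ge> 2" and k: "k \<ge> 2" and pq: "p > q" and q: "q \<ge> 0" and C: "C > 1"
    and \<alpha>: "\<And>n. 0 \<le> \<alpha> n"
    and sparse: "(\<lambda>n. real (n choose d) * \<alpha> n) \<in> o(\<lambda>n. real n * ln (real n))"
begin

text \<open>Up to the factor \<open>p\<close>, \<open>deg\<close> bounds the expected number of edges of weight 1 at a node, and \<open>codeg\<close>
  the expected number of those that contain two given nodes.\<close>

definition deg :: "nat \<Rightarrow> real" where
  "deg n = \<alpha> n * real ((n - 1) choose (d - 1))"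

definition codeg :: "nat \<Rightarrow> real" where
  "codeg n = \<alpha> n * real ((n - 2) choose (d - 2))"

lemma deg_eq: "n > 0 \<Longrightarrow> deg n = real d * (real (n choose d) * \<alpha> n / n)"
proof -
  assume n: "n > 0"
  have "d * (n choose d) = n * ((n - 1) choose (d - 1))"
    using d by (intro times_binomial_minus1_eq) simp
  hence "real d * real (n choose d) = real n * real ((n - 1) choose (d - 1))"
    by (simp only: of_nat_mult[symmetric])
  thus ?thesis using n by (simp add: deg_def field_simps)
qed

lemma deg_nonneg: "0 \<le> deg n"
  using \<alpha> by (simp add: deg_def)

lemma deg_over_ln: "(\<lambda>n. deg n / ln (real n)) \<longlonglongrightarrow> 0"
proof -
  have "(\<lambda>n. real d * (real (n choose d) * \<alpha> n / (real n * ln (real n)))) \<longlonglongrightarrow> real d * 0"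
    by (intro tendsto_mult tendsto_const smalloD_tendsto sparse)
  moreover have "\<forall>\<^sub>F n in sequentially. real d * (real (n choose d) * \<alpha> n / (real n * ln (real n))) =
      deg n / ln (real n)"
    using eventually_gt_at_top[of 0] by eventually_elim (simp add: deg_eq)
  ultimately show ?thesis by (auto intro: Lim_transform_eventually)
qed

text \<open>\<open>codeg n\<close> is smaller than \<open>deg n\<close> by the factor \<open>(n - 1) / (d - 1)\<close>, which outgrows the logarithm that
  \<open>deg n\<close> may contain.\<close>

lemma codeg_tendsto: "codeg \<longlonglongrightarrow> 0"
proof -
  have "(\<lambda>n. ln (real n) / (real n - 1)) \<longlonglongrightarrow> 0" by real_asymp
  from tendsto_mult_left[OF tendsto_mult[OF deg_over_ln this], of "real d - 1"]
  have "(\<lambda>n. (real d - 1) * (deg n / ln (real n) * (ln (real n) / (real n - 1)))) \<longlonglongrightarrow> 0"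
    by simp
  moreover have "\<forall>\<^sub>F n in sequentially.
      (real d - 1) * (deg n / ln (real n) * (ln (real n) / (real n - 1))) = codeg n"
    using eventually_gt_at_top[of 1]
  proof eventually_elim
    case (elim n)
    have "(d - 1) * ((n - 1) choose (d - 1)) = (n - 1) * ((n - 1 - 1) choose (d - 1 - 1))"
      using d by (intro times_binomial_minus1_eq) simp
    hence "real (d - 1) * real ((n - 1) choose (d - 1)) = real (n - 1) * real ((n - 2) choose (d - 2))"
      by (simp only: of_nat_mult[symmetric] diff_diff_left one_add_one)
    hence "(real d - 1) * real ((n - 1) choose (d - 1)) = (real n - 1) * real ((n - 2) choose (d - 2))"
      using d elim by (simp add: of_nat_diff)
    hence "(real d - 1) * deg n = (real n - 1) * codeg n"
      unfolding deg_def codeg_def by (metis mult.left_commute)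
    thus ?case using elim by (simp add: nonzero_divide_eq_eq mult.commute)
  qed
  ultimately show ?thesis by (auto intro: Lim_transform_eventually)
qed

lemma alpha_tendsto: "\<alpha> \<longlonglongrightarrow> 0"
proof (rule tendsto_sandwich[OF _ _ tendsto_const codeg_tendsto])
  show "\<forall>\<^sub>F n in sequentially. \<alpha> n \<le> codeg n"
    using eventually_ge_at_top[of d]
  proof eventually_elim
    case (elim n)
    have "(n - 2) choose (d - 2) \<ge> 1"
      using elim by (simp add: Suc_le_eq)
    hence "\<alpha> n * 1 \<le> codeg n"
      unfolding codeg_def using \<alpha> by (intro mult_left_mono) auto
    thus ?case by simp
  qed
qed (simp add: \<alpha>)

lemma eventually_pa_le: "\<forall>\<^sub>F n in sequentially. p * \<alpha> n \<le> 1 / 2"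
proof -
  have "(\<lambda>n. p * \<alpha> n) \<longlonglongrightarrow> p * 0" by (intro tendsto_mult tendsto_const alpha_tendsto)
  hence "\<forall>\<^sub>F n in sequentially. p * \<alpha> n < 1 / 2" by (intro order_tendstoD) auto
  thus ?thesis by eventually_elim simp
qed

lemma p_pos: "p > 0" and k_pos: "k > 0"
  using pq q k by auto

text \<open>The value of \<open>isolation_bound\<close> at \<open>n\<close>.\<close>

definition rho :: "nat \<Rightarrow> real" where
  "rho n = exp (- 2 * p * k * deg n)"

lemma rho_eq: "rho n = exp (- 2 * p * \<alpha> n * real (k * ((n - 1) choose (d - 1))))"
  by (simp add: rho_def deg_def mult_ac)

lemma rho_le_1: "rho n \<le> 1"
  using deg_nonneg[of n] p_pos by (simp add: rho_def mult_nonneg_nonneg)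

text \<open>Here the expected degrees tend to 0, so that a block is isolated with probability tending to 1. The
  constant of detection may depend on the hidden partitions. Therefore detection is excluded for
  constants \<open>\<epsilon> n\<close> that tend to 0, which eventually fall below any given one.\<close>

lemma no_detection:
  assumes "(\<lambda>n. real (n choose d) * \<alpha> n) \<in> o(\<lambda>n. real n)"
    and \<Phi>: "is_estimator k \<Phi>" "solves_detection d k C p q \<alpha> \<Phi>"
  shows False
proof -
  have "(\<lambda>n. real d * (real (n choose d) * \<alpha> n / real n)) \<longlonglongrightarrow> real d * 0"
    by (intro tendsto_mult tendsto_const smalloD_tendsto assms)
  moreover have "\<forall>\<^sub>F n in sequentially. real d * (real (n choose d) * \<alpha> n / real n) = deg n"
    using eventually_gt_at_top[of 0] by eventually_elim (simp add: deg_eq)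
  ultimately have deg: "deg \<longlonglongrightarrow> 0" by (auto intro: Lim_transform_eventually)
  define \<theta> where "\<theta> n = 1 / real (n div k) + (1 - rho n)" for n
  \<comment> \<open>With this choice the bound of \<open>detection_bound\<close> is exactly \<open>1 / 2\<close>.\<close>
  define \<epsilon> where "\<epsilon> n = sqrt (8 * real k ^ 5 * \<theta> n)" for n
  have "rho \<longlonglongrightarrow> exp (- 2 * p * k * 0)"
    unfolding rho_def by (intro tendsto_intros deg)
  hence rho: "rho \<longlonglongrightarrow> 1" by simp
  have "filterlim (\<lambda>n. real (n div k)) at_top sequentially"
    by (rule filterlim_compose[OF filterlim_real_sequentially filterlim_div_at_top[OF k_pos]])
  hence "(\<lambda>n. 1 / real (n div k)) \<longlonglongrightarrow> 0"
    by (intro tendsto_divide_0[OF tendsto_const] filterlim_at_top_imp_at_infinity)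
  hence "\<theta> \<longlonglongrightarrow> 0 + (1 - 1)"
    unfolding \<theta>_def by (intro tendsto_intros rho)
  hence "\<epsilon> \<longlonglongrightarrow> sqrt (8 * real k ^ 5 * 0)"
    unfolding \<epsilon>_def by (intro tendsto_intros) simp
  hence \<epsilon>: "\<epsilon> \<longlonglongrightarrow> 0" by simp
  have "\<forall>\<^sub>F n in sequentially. \<exists>r. measure_pmf.prob
      (bind_pmf (sbm_pmf d p q (\<alpha> n) n (shifted_labeling n k r)) (\<Phi> n))
      {\<phi>. detects k n (\<epsilon> n) (shifted_labeling n k r) \<phi>} \<le> 1 / 2"
    using eventually_pa_le eventually_ge_at_top[of k]
  proof eventually_elim
    case (elim n)
    define m where "m = n div k"
    interpret shifted_model d k n m p q "\<alpha> n" "\<Phi> n"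
      using \<Phi> k pq q \<alpha> elim by (intro shifted_model_estimator) (auto simp: m_def)
    have ib: "isolation_bound = rho n" by (simp only: isolation_bound_def rho_eq)
    have m: "1 \<le> m" using div_le_mono[OF elim(2), of k] k_pos by (simp add: m_def)
    have \<theta>: "1 / real m \<le> \<theta> n" "0 < \<theta> n"
      using rho_le_1[of n] m by (simp_all add: \<theta>_def m_def add_pos_nonneg)
    have k5: "2 \<le> real k ^ 5" using power_mono[of 2 "real k" 5] k by simp
    have \<epsilon>2: "(\<epsilon> n)\<^sup>2 = 8 * real k ^ 5 * \<theta> n" using \<theta> by (simp add: \<epsilon>_def)
    have \<epsilon>pos: "0 < \<epsilon> n" using \<theta> k_pos by (simp add: \<epsilon>_def)
    have "4\<^sup>2 \<le> (8 * 2 * (1 / real m)) * (real m)\<^sup>2" using m by (simp add: power2_eq_square)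
    also have "\<dots> \<le> (8 * real k ^ 5 * \<theta> n) * (real m)\<^sup>2"
      using k5 \<theta> m by (intro mult_right_mono mult_mono) auto
    also have "\<dots> = (\<epsilon> n * m)\<^sup>2" by (simp add: power_mult_distrib \<epsilon>2)
    finally have "4 \<le> \<epsilon> n * m" by (rule power2_le_imp_le) (use \<epsilon>pos in simp)
    from detection_bound[OF m_def _ this \<epsilon>pos] m obtain r where
      "measure_pmf.prob (outcome r) {\<phi>. detects k n (\<epsilon> n) (shifted_labeling n k r) \<phi>}
        \<le> 4 * real k ^ 5 * \<theta> n / (\<epsilon> n)\<^sup>2"
      unfolding ib \<theta>_def m_def by auto
    also have "\<dots> = 1 / 2" unfolding \<epsilon>2 using \<theta> k_pos by simp
    finally show ?case by blast
  qed
  then obtain \<Psi> where \<Psi>: "admissible_seq C k \<Psi>" "\<forall>\<^sub>F n in sequentially. measure_pmf.prob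
      (bind_pmf (sbm_pmf d p q (\<alpha> n) n (\<Psi> n)) (\<Phi> n)) {\<phi>. detects k n (\<epsilon> n) (\<Psi> n) \<phi>} \<le> 1 / 2"
    by (rule choose_admissible_seq[OF k_pos C])
  obtain \<epsilon>0 where \<epsilon>0: "\<epsilon>0 > 0" "(\<lambda>n. measure_pmf.prob (output_pmf d p q \<alpha> \<Psi> \<Phi> n)
      {\<phi>. detects k n \<epsilon>0 (\<Psi> n) \<phi>}) \<longlonglongrightarrow> 1"
    using \<Phi>(2) \<Psi>(1) unfolding solves_detection_def by blast
  have "\<forall>\<^sub>F n in sequentially. \<epsilon> n < \<epsilon>0" using \<epsilon> \<epsilon>0(1) by (rule order_tendstoD)
  with \<Psi>(2) have "\<forall>\<^sub>F n in sequentially. measure_pmf.prob (output_pmf d p q \<alpha> \<Psi> \<Phi> n)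
      {\<phi>. detects k n \<epsilon>0 (\<Psi> n) \<phi>} \<le> 1 / 2"
  proof eventually_elim
    case (elim n)
    have "measure_pmf.prob (output_pmf d p q \<alpha> \<Psi> \<Phi> n) {\<phi>. detects k n \<epsilon>0 (\<Psi> n) \<phi>} \<le>
        measure_pmf.prob (output_pmf d p q \<alpha> \<Psi> \<Phi> n) {\<phi>. detects k n (\<epsilon> n) (\<Psi> n) \<phi>}"
      using elim(2) by (intro measure_pmf.finite_measure_mono) (auto intro: detects_mono)
    with elim(1) show ?case by (simp add: output_pmf_def)
  qed
  from tendsto_not_eventually_le[OF \<epsilon>0(2) this] show False by simp
qed

text \<open>Bounded expected degrees keep the isolation probability of a block above a constant \<open>\<rho>\<close>, so a constant
  fraction of the blocks is misclassified with positive probability.\<close>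

lemma no_weak_consistency:
  assumes "(\<lambda>n. real (n choose d) * \<alpha> n) \<in> O(\<lambda>n. real n)"
    and \<Phi>: "is_estimator k \<Phi>" "weakly_consistent d k C p q \<alpha> \<Phi>"
  shows False
proof -
  obtain c where c: "\<forall>\<^sub>F n in sequentially. norm (real (n choose d) * \<alpha> n) \<le> c * norm (real n)"
    using assms(1) by (elim landau_o.bigE) auto
  define \<rho> where "\<rho> = exp (- 2 * p * k * (d * c))"
  \<comment> \<open>At least \<open>n / (8 * k)\<close> blocks are free, so \<open>\<epsilon> * n\<close> is at most \<open>\<rho> / 4\<close> times their number.\<close>
  define \<epsilon> where "\<epsilon> = \<rho> / (32 * k)"
  have \<epsilon>: "\<epsilon> > 0" using k_pos by (simp add: \<epsilon>_def \<rho>_def)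
  have "\<forall>\<^sub>F n in sequentially. \<rho> \<le> rho n"
    using c eventually_gt_at_top[of 0]
  proof eventually_elim
    case (elim n)
    hence "real (n choose d) * \<alpha> n / n \<le> c" using \<alpha>[of n] by (simp add: field_simps)
    hence "deg n \<le> d * c" unfolding deg_eq[OF elim(2)] by (intro mult_left_mono) auto
    thus ?case unfolding \<rho>_def rho_def using p_pos k_pos by simp
  qed
  hence "\<forall>\<^sub>F n in sequentially. \<exists>r. \<rho> / 4 \<le> measure_pmf.prob
      (bind_pmf (sbm_pmf d p q (\<alpha> n) n (shifted_labeling n k r)) (\<Phi> n))
      {\<phi>. err k n (shifted_labeling n k r) \<phi> > \<epsilon>}"
    using eventually_pa_le eventually_ge_at_top[of "2 * k"]
  proof eventually_elim
    case (elim n)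
    define m where "m = n div k div 2"
    note half = half_blocks_bounds[OF k_pos elim(3), folded m_def]
    interpret shifted_model d k n m p q "\<alpha> n" "\<Phi> n"
      using \<Phi> k pq q \<alpha> elim by (intro shifted_model_estimator) (auto simp: m_def)
    have ib: "isolation_bound = rho n" by (simp only: isolation_bound_def rho_eq)
    have "0 < \<rho>" by (simp add: \<rho>_def)
    hence \<rho>1: "\<rho> \<le> 1" "0 < \<rho>" using elim(1) rho_le_1[of n] by auto
    have en: "\<epsilon> * n = \<rho> * (real n / (8 * k)) / 4" by (simp add: \<epsilon>_def)
    have "\<rho> * (real n / (8 * k)) \<le> 1 * (real n / (8 * k))"
      using \<rho>1 by (intro mult_right_mono) auto
    hence "2 * \<epsilon> * n \<le> real n / (8 * k) / 2" using en by simp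
    also have "\<dots> < real n / (4 * k)" using elim(3) k_pos by (simp add: field_simps)
    also have "\<dots> \<le> real (n div k) - real m" by (rule half(3))
    finally have gap: "2 * \<epsilon> * n < real (n div k) - real m" .
    have "\<rho> * (real n / (8 * k)) \<le> rho n * m"
      using elim(1) half(4) \<rho>1 by (intro mult_mono) auto
    hence small: "\<epsilon> * n \<le> isolation_bound / 4 * m" unfolding ib en by simp
    from weak_consistency_bound[OF half(1) gap small] obtain r where
      r: "measure_pmf.prob (outcome r) {\<phi>. err k n (shifted_labeling n k r) \<phi> \<le> \<epsilon>} \<le> 1 - rho n / 4"
      unfolding ib by blast
    have "{\<phi>. err k n (shifted_labeling n k r) \<phi> > \<epsilon>} =
        - {\<phi>. err k n (shifted_labeling n k r) \<phi> \<le> \<epsilon>}" by auto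
    hence "measure_pmf.prob (outcome r) {\<phi>. err k n (shifted_labeling n k r) \<phi> > \<epsilon>} =
        1 - measure_pmf.prob (outcome r) {\<phi>. err k n (shifted_labeling n k r) \<phi> \<le> \<epsilon>}"
      using measure_pmf.prob_compl[of "{\<phi>. err k n (shifted_labeling n k r) \<phi> \<le> \<epsilon>}" "outcome r"]
      by (simp add: Compl_eq_Diff_UNIV)
    with r elim(1) have "\<rho> / 4 \<le> measure_pmf.prob (outcome r) {\<phi>. err k n (shifted_labeling n k r) \<phi> > \<epsilon>}"
      by linarith
    thus ?case by blast
  qed
  then obtain \<Psi> where \<Psi>: "admissible_seq C k \<Psi>" "\<forall>\<^sub>F n in sequentially. \<rho> / 4 \<le> measure_pmf.prob
      (bind_pmf (sbm_pmf d p q (\<alpha> n) n (\<Psi> n)) (\<Phi> n)) {\<phi>. err k n (\<Psi> n) \<phi> > \<epsilon>}"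
    by (rule choose_admissible_seq[OF k_pos C])
  have lim: "(\<lambda>n. measure_pmf.prob (output_pmf d p q \<alpha> \<Psi> \<Phi> n) {\<phi>. err k n (\<Psi> n) \<phi> > \<epsilon>}) \<longlonglongrightarrow> 0"
    using \<Phi>(2) \<Psi>(1) \<epsilon> unfolding weakly_consistent_def by blast
  have "\<rho> / 4 \<le> 0"
    by (rule tendsto_lowerbound[OF lim \<Psi>(2)[folded output_pmf_def]]) simp
  thus False by (simp add: \<rho>_def)
qed

text \<open>With expected degrees of order \<open>o (ln n)\<close> a block is isolated with probability at least \<open>1 / sqrt n\<close>,
  whereas the number of free blocks is linear in \<open>n\<close>. So an isolated free block is likely to exist.\<close>

lemma no_strong_consistency:
  assumes \<Phi>: "is_estimator k \<Phi>" "strongly_consistent d k C p q \<alpha> \<Phi>"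
  shows False
proof -
  define z where "z n = exp (- 2 * p * \<alpha> n * real (k\<^sup>2 * ((n - 2) choose (d - 2))))" for n
  have z_eq: "z = (\<lambda>n. exp (- 2 * p * (real k)\<^sup>2 * codeg n))"
    by (auto simp: z_def codeg_def mult_ac)
  have "(\<lambda>n. 1 / z n - 1) \<longlonglongrightarrow> 1 / exp (- 2 * p * (real k)\<^sup>2 * 0) - 1"
    unfolding z_eq by (intro tendsto_intros codeg_tendsto) simp
  hence "(\<lambda>n. 1 / z n - 1) \<longlonglongrightarrow> 0" by simp
  hence z: "\<forall>\<^sub>F n in sequentially. 1 / z n - 1 < 1 / 8" by (rule order_tendstoD) simp
  \<comment> \<open>The constant is chosen so that \<open>2 * p * k * deg n \<le> ln n / 2\<close>.\<close>
  have "\<forall>\<^sub>F n in sequentially. deg n / ln (real n) < 1 / (4 * p * k)"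
    using deg_over_ln by (rule order_tendstoD) (use p_pos k_pos in simp)
  hence rho: "\<forall>\<^sub>F n in sequentially. 1 / sqrt n \<le> rho n"
    using eventually_gt_at_top[of 1]
  proof eventually_elim
    case (elim n)
    hence "deg n \<le> 1 / (4 * p * k) * ln n"
      by (simp add: pos_divide_less_eq)
    hence "2 * p * k * deg n \<le> 2 * p * k * (1 / (4 * p * k) * ln n)"
      using p_pos k_pos by (intro mult_left_mono) auto
    also have "\<dots> = ln n / 2" using p_pos k_pos by simp
    finally have "exp (- (ln n / 2)) \<le> rho n" by (simp add: rho_def)
    moreover have "exp (- (ln n / 2)) = 1 / sqrt n"
    proof -
      have n0: "0 < sqrt (real n)" using elim(2) by simp
      have "ln (real n) / 2 = ln (sqrt (real n))"
        using elim(2) by (simp add: ln_sqrt)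
      thus ?thesis using exp_ln[OF n0] by (simp only: exp_minus inverse_eq_divide)
    qed
    ultimately show ?case by simp
  qed
  have "\<forall>\<^sub>F n in sequentially. \<exists>r. measure_pmf.prob
      (bind_pmf (sbm_pmf d p q (\<alpha> n) n (shifted_labeling n k r)) (\<Phi> n))
      {\<phi>. err k n (shifted_labeling n k r) \<phi> \<le> 0} \<le> 3 / 4"
    using z rho eventually_pa_le eventually_ge_at_top[of "2 * k"] eventually_ge_at_top[of "(64 * k)\<^sup>2"]
  proof eventually_elim
    case (elim n)
    define m where "m = n div k div 2"
    note half = half_blocks_bounds[OF k_pos elim(4), folded m_def]
    interpret shifted_model d k n m p q "\<alpha> n" "\<Phi> n"
      using \<Phi> k pq q \<alpha> elim by (intro shifted_model_estimator) (auto simp: m_def)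
    have ib: "isolation_bound = rho n" by (simp only: isolation_bound_def rho_eq)
    have pb: "pair_bound = z n" by (simp only: pair_bound_def z_def)
    have n0: "0 < real n" using elim(4) k_pos by simp
    have "(real (64 * k))\<^sup>2 \<le> real n"
      using elim(5) by (simp only: of_nat_power[symmetric] of_nat_le_iff)
    hence "64 * real k \<le> sqrt n" by (simp add: real_le_rsqrt)
    hence "8 \<le> sqrt n / (8 * k)" using k_pos by (simp add: field_simps)
    also have "\<dots> = real n / (8 * k) * (1 / sqrt n)"
    proof -
      have "real n * (1 / sqrt n) = sqrt n"
        using real_div_sqrt[of "real n"] by simp
      thus ?thesis by (simp only: times_divide_eq_left)
    qed
    also have "\<dots> \<le> real m * rho n"
      using half(4) elim(2) n0 by (intro mult_mono) auto
    finally have "1 / (real m * rho n) \<le> 1 / 8"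
      using frac_le[of 1 1 8 "real m * rho n"] by simp
    hence "measure_pmf.prob (law r) {w. \<forall>b<m. \<not> isolated d n w (block k b)} \<le> 1 / 4" for r
      using prob_no_isolated_block[OF half(1), of r] elim(1) unfolding ib pb by linarith
    from strong_consistency_bound[OF half(2) this] show ?case by auto
  qed
  then obtain \<Psi> where \<Psi>: "admissible_seq C k \<Psi>" "\<forall>\<^sub>F n in sequentially. measure_pmf.prob
      (bind_pmf (sbm_pmf d p q (\<alpha> n) n (\<Psi> n)) (\<Phi> n)) {\<phi>. err k n (\<Psi> n) \<phi> \<le> 0} \<le> 3 / 4"
    by (rule choose_admissible_seq[OF k_pos C])
  have lim: "(\<lambda>n. measure_pmf.prob (output_pmf d p q \<alpha> \<Psi> \<Phi> n) {\<phi>. err k n (\<Psi> n) \<phi> = 0}) \<longlonglongrightarrow> 1"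
    using \<Phi>(2) \<Psi>(1) unfolding strongly_consistent_def by blast
  have "\<forall>\<^sub>F n in sequentially. measure_pmf.prob (output_pmf d p q \<alpha> \<Psi> \<Phi> n) {\<phi>. err k n (\<Psi> n) \<phi> = 0} \<le> 3 / 4"
    using \<Psi>(2)
  proof eventually_elim
    case (elim n)
    have "measure_pmf.prob (output_pmf d p q \<alpha> \<Psi> \<Phi> n) {\<phi>. err k n (\<Psi> n) \<phi> = 0} \<le>
        measure_pmf.prob (output_pmf d p q \<alpha> \<Psi> \<Phi> n) {\<phi>. err k n (\<Psi> n) \<phi> \<le> 0}"
      by (intro measure_pmf.finite_measure_mono) auto
    with elim show ?case by (simp add: output_pmf_def)
  qed
  from tendsto_not_eventually_le[OF lim this] show False by simp
qed

end

theorem proposition1: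
  fixes d k :: nat and p q C :: real and \<alpha> :: "nat \<Rightarrow> real"
  assumes "d \<ge> 2" and "k \<ge> 2" and "p > q" and "q \<ge> 0" and "C > 1"
    and "\<And>n. 0 \<le> \<alpha> n" and "\<And>n. p * \<alpha> n \<le> 1"
  shows "((\<lambda>n. real (n choose d) * \<alpha> n) \<in> o(\<lambda>n. real n) \<longrightarrow>
            \<not> (\<exists>\<Phi>. is_estimator k \<Phi> \<and> solves_detection d k C p q \<alpha> \<Phi>)) \<and>
         ((\<lambda>n. real (n choose d) * \<alpha> n) \<in> O(\<lambda>n. real n) \<longrightarrow>
            \<not> (\<exists>\<Phi>. is_estimator k \<Phi> \<and> weakly_consistent d k C p q \<alpha> \<Phi>)) \<and>
         ((\<lambda>n. real (n choose d) * \<alpha> n) \<in> o(\<lambda>n. real n * ln (real n)) \<longrightarrow>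
            \<not> (\<exists>\<Phi>. is_estimator k \<Phi> \<and> strongly_consistent d k C p q \<alpha> \<Phi>))"
proof -
  let ?e = "\<lambda>n. real (n choose d) * \<alpha> n"
  have regime: "sparse_regime d k p q C \<alpha>" if "?e \<in> o(\<lambda>n. real n * ln (real n))"
    using that assms by unfold_locales auto
  have n: "(\<lambda>n. real n) \<in> o(\<lambda>n. real n * ln (real n))"
    by real_asymp
  have O: "?e \<in> o(\<lambda>n. real n * ln (real n))" if "?e \<in> O(\<lambda>n. real n)"
    using that n by (rule landau_o.big_small_trans)
  have o: "?e \<in> O(\<lambda>n. real n)" if "?e \<in> o(\<lambda>n. real n)"
    using that by (rule landau_o.small_imp_big)
  show ?thesis
    using sparse_regime.no_detection[OF regime[OF O[OF o]]]
      sparse_regime.no_weak_consistency[OF regime[OF O]]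
      sparse_regime.no_strong_consistency[OF regime] by blast
qed

end
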